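(* Let $\mathcal{E}=(L|K,v)$ be an Artin-Schreier defect extension (of degree $p=\operatorname{char}K$) generated by $\vartheta\in L$ with $\vartheta^p-\vartheta=a\in K$. Then $v(\vartheta-c)<0$ and $v(a-\wp(c))=p\,v(\vartheta-c)$ for all $c\in K$, and therefore $$v(a-\wp(K))=p\,v(\vartheta-K).$$ Further, the following are equivalent: a) $\mathcal{E}$ has independent defect; b) $v(\vartheta-K)=-\{\alpha\in vK\mid\alpha>H\}$ for some strongly convex subgroup $H$ of $vK$; c) $v(a-\wp(K))=-\{\alpha\in pvK\mid\alpha>H\}$ for some strongly convex subgroup $H$ of $vK$; d) there is some strongly convex subgroup $H$ of $vK$ such that for all $b\in K$ such that $vb>H$ there is $c\in K$ satisfying $v(a-\wp(c))\ge-vb$. If $vK$ is $p$-divisible, then these properties are also equivalent to e) $p\,v(\vartheta-K)=v(\vartheta-K)$; f) $v(a-\wp(K))=v(\vartheta-K)$. If $(K,v)$ has rank $1$, then condition d) is equivalent to: g) for all $b\in\mathcal{O}_K$ there is $c\in K$ satisfying $v(a-\wp(c))\ge-vb$.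
   Context: $(L|K,v)$ denotes a field extension $L|K$ with a (Krull) valuation $v$ on $L$ of arbitrary rank (written additively, $v0=\infty$), $K$ being endowed with the restriction of $v$. $\mathcal{O}_K$ is the valuation ring of $K$, $vL,vK$ are the value groups, $Lv,Kv$ the residue fields. Rank $1$ means that $\{0\}$ is the only proper convex subgroup of $vK$. $\wp(X)=X^p-X$ and $\wp(K)=\{\wp(c)\mid c\in K\}$. For an element $z$ and a set $S$, $v(z-S)=\{v(z-c)\mid c\in S\}$. For a subset $M$ of an ordered abelian group, $-M=\{-m\mid m\in M\}$ and $pM=\{pm\mid m\in M\}$. An inequality between an element and a subset, such as $\alpha>H$, means that it holds for all elements of the subset. $(L|K,v)$ is unibranched if the extension of $v$ from $K$ to $L$ is unique. For a finite unibranched extension, $[L:K]=\tilde p^{\,\nu}(vL:vK)[Lv:Kv]$ with an integer $\nu\ge0$, where $\tilde p=\operatorname{char}Kv$ if this is positive and $\tilde p=1$ otherwise; it is a defect extension if $\tilde p^{\,\nu}>1$. A defect extension of prime degree is always tacitly assumed to be unibranched; hence its degree is $p=\operatorname{char}Kv$, $vL=vK$ and $Lv=Kv$. An Artin-Schreier extension is a Galois extension of degree $p$ of a field $K$ of characteristic $p$, generated by a root of a polynomial $X^p-X-a$, $a\in K$. For $\mathrm{id}\neq\sigma\in\operatorname{Gal}(L|K)$, the set $\Sigma_{\mathcal{E}}=\{v(\frac{\sigma b-b}{b})\mid b\in L^\times,\ \sigma b\ne b\}$ is a final segment of $vL^{>0}$ and does not depend on the choice of $\sigma$. A strongly convex subgroup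 of an ordered abelian group $\Gamma$ is a proper convex subgroup $H$ such that $\Gamma/H$ has no smallest positive element. $\mathcal{E}$ has independent defect if $\Sigma_{\mathcal{E}}=\{\alpha\in vL\mid\alpha>H\}$ for some strongly convex subgroup $H$ of $vL$.
   Formalization: In the general equivalence, d) additionally requires v(a-℘(c))<H for all c∈K (as printed, d) does not imply a) in higher rank; in rank 1 d) is unchanged); in g), b ranges over the maximal ideal vb>0 instead of O_K, since b=1 contradicts v(a-℘(c))<0. *)

theory Defs
  imports
    "HOL-Library.Extended"
    "HOL-Algebra.Embedded_Algebras"
    "HOL-Algebra.Generated_Fields"
    "HOL-Algebra.QuotRing"
    "HOL-Algebra.Algebraic_Closure_Type"
begin

section \<open>Ordered abelian groups\<close>

text \<open>
  Value groups are subgroups of an ambient ordered abelian group, so that the value group of a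
  subfield is literally a subgroup of the value group of the whole field. Since \<open>- M\<close> denotes the
  complement of a set, the set of negatives is written \<open>uminus ` M\<close>.
\<close>

definition nmult :: "nat \<Rightarrow> 'a::comm_monoid_add \<Rightarrow> 'a"
  where "nmult n x = (\<Sum>i<n. x)"

definition add_subgroup :: "'g::ab_group_add set \<Rightarrow> 'g set \<Rightarrow> bool"
  where "add_subgroup H G \<longleftrightarrow> H \<subseteq> G \<and> 0 \<in> H \<and> (\<forall>x\<in>H. \<forall>y\<in>H. x + y \<in> H) \<and> (\<forall>x\<in>H. - x \<in> H)"

definition convex_subgroup :: "'g::linordered_ab_group_add set \<Rightarrow> 'g set \<Rightarrow> bool"
  where "convex_subgroup H G \<longleftrightarrow>
    add_subgroup H G \<and> (\<forall>x\<in>H. \<forall>z\<in>H. \<forall>y\<in>G. x \<le> y \<and> y \<le> z \<longrightarrow> y \<in> H)"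

definition cosets :: "'g::ab_group_add set \<Rightarrow> 'g set \<Rightarrow> 'g set set"
  where "cosets G H = (\<lambda>g. (\<lambda>h. g + h) ` H) ` G"

text \<open>
  For a convex subgroup \<open>H\<close>, the order of the quotient is the relation \<open>coset_le\<close> on \<open>cosets G H\<close>,
  with zero element \<open>H\<close>.
\<close>

definition coset_le :: "'g::linorder set \<Rightarrow> 'g set \<Rightarrow> bool"
  where "coset_le A B \<longleftrightarrow> (\<exists>x\<in>A. \<exists>y\<in>B. x \<le> y)"

definition positive_cosets :: "'g::linordered_ab_group_add set \<Rightarrow> 'g set \<Rightarrow> 'g set set"
  where "positive_cosets G H = {A \<in> cosets G H. A \<noteq> H \<and> coset_le H A}"

definition strongly_convex_subgroup :: "'g::linordered_ab_group_add set \<Rightarrow> 'g set \<Rightarrow> bool"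
  where "strongly_convex_subgroup H G \<longleftrightarrow>
    convex_subgroup H G \<and> H \<noteq> G \<and>
    \<not> (\<exists>A\<in>positive_cosets G H. \<forall>B\<in>positive_cosets G H. coset_le A B)"

definition elems_above :: "'g::linorder set \<Rightarrow> 'g set \<Rightarrow> 'g set"
  where "elems_above G H = {\<alpha>\<in>G. \<forall>h\<in>H. h < \<alpha>}"

definition rank_one :: "'g::linordered_ab_group_add set \<Rightarrow> bool"
  where "rank_one G \<longleftrightarrow> {H. convex_subgroup H G \<and> H \<noteq> G} = {{0}}"

definition n_divisible :: "nat \<Rightarrow> 'g::ab_group_add set \<Rightarrow> bool"
  where "n_divisible n G \<longleftrightarrow> (\<forall>\<alpha>\<in>G. \<exists>\<beta>\<in>G. nmult n \<beta> = \<alpha>)"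


section \<open>Krull valuations\<close>

text \<open>
  The field \<open>L\<close> is a type, \<open>K\<close> is a subfield of it, and \<open>K\<close> carries the restriction of \<open>v\<close>.
\<close>

definition valuation :: "('l::field \<Rightarrow> 'g::linordered_ab_group_add extended) \<Rightarrow> bool"
  where "valuation v \<longleftrightarrow>
    (\<forall>x. v x = \<infinity> \<longleftrightarrow> x = 0) \<and> (\<forall>x. v x \<noteq> -\<infinity>) \<and>
    (\<forall>x y. v (x * y) = v x + v y) \<and> (\<forall>x y. min (v x) (v y) \<le> v (x + y))"

definition value_group :: "('l::field \<Rightarrow> 'g::linordered_ab_group_add extended) \<Rightarrow> 'l set \<Rightarrow> 'g set"
  where "value_group v K = {\<gamma>. \<exists>x\<in>K. x \<noteq> 0 \<and> v x = Fin \<gamma>}"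

definition val_ring :: "('l::field \<Rightarrow> 'g::linordered_ab_group_add extended) \<Rightarrow> 'l set \<Rightarrow> 'l set"
  where "val_ring v K = {x\<in>K. 0 \<le> v x}"

definition val_ideal :: "('l::field \<Rightarrow> 'g::linordered_ab_group_add extended) \<Rightarrow> 'l set \<Rightarrow> 'l set"
  where "val_ideal v K = {x\<in>K. 0 < v x}"

definition residue_field ::
    "('l::field \<Rightarrow> 'g::linordered_ab_group_add extended) \<Rightarrow> 'l set \<Rightarrow> 'l set ring"
  where "residue_field v K = (ring_of_type_algebra\<lparr>carrier := val_ring v K\<rparr>) Quot val_ideal v K"

text \<open>The image of \<open>Kv\<close> under its canonical embedding into \<open>Lv\<close>.\<close>

definition residue_subfield ::
    "('l::field \<Rightarrow> 'g::linordered_ab_group_add extended) \<Rightarrow> 'l set \<Rightarrow> 'l set set"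
  where "residue_subfield v K =
    (\<lambda>x. val_ideal v UNIV +>\<^bsub>ring_of_type_algebra\<lparr>carrier := val_ring v UNIV\<rparr>\<^esub> x) ` val_ring v K"

definition ring_char :: "('a, 'b) ring_scheme \<Rightarrow> nat"
  where "ring_char R =
    (if \<exists>n::nat. n > 0 \<and> [n] \<cdot>\<^bsub>R\<^esub> \<one>\<^bsub>R\<^esub> = \<zero>\<^bsub>R\<^esub>
     then LEAST n::nat. n > 0 \<and> [n] \<cdot>\<^bsub>R\<^esub> \<one>\<^bsub>R\<^esub> = \<zero>\<^bsub>R\<^esub> else 0)"

definition value_set :: "('l::field \<Rightarrow> 'g extended) \<Rightarrow> 'l \<Rightarrow> 'l set \<Rightarrow> 'g extended set"
  where "value_set v z S = {v (z - c) |c. c \<in> S}"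


section \<open>Unibranched extensions and defect\<close>

definition is_valuation_ring :: "'l::field set \<Rightarrow> bool"
  where "is_valuation_ring R \<longleftrightarrow>
    subring R ring_of_type_algebra \<and> (\<forall>x. x \<noteq> 0 \<longrightarrow> x \<in> R \<or> inverse x \<in> R)"

text \<open>
  Uniqueness of extensions of a valuation is meant up to equivalence, and the values of an
  extension of \<open>v\<close> from \<open>K\<close> to \<open>L\<close> need not lie in the ambient group of \<open>v\<close>. Equivalence classes of
  valuations of \<open>L\<close> correspond to the valuation rings of \<open>L\<close>, and the extensions of \<open>v\<close> from \<open>K\<close> to
  \<open>L\<close> are those whose valuation ring meets \<open>K\<close> in the valuation ring of \<open>(K,v)\<close>. The next lemmas
  record one half of this correspondence, for arbitrary value groups.
\<close>

lemma valuation_one: "valuation v \<Longrightarrow> v 1 = 0"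
proof -
  assume v: "valuation v"
  then obtain g where g: "v 1 = Fin g"
    unfolding valuation_def by (metis extended.exhaust zero_neq_one)
  have "v 1 = v 1 + v 1" using v unfolding valuation_def by (metis mult_1)
  then show ?thesis using g by (simp add: zero_extended_def)
qed

lemma valuation_inverse_ge:
  assumes v: "valuation v" and y: "y \<noteq> 0"
  shows "0 \<le> v (x * inverse y) \<longleftrightarrow> v y \<le> v x"
proof -
  obtain g where g: "v y = Fin g"
    using v y unfolding valuation_def by (metis extended.exhaust)
  have "v x = v (x * inverse y * y)" using y by (simp add: mult.assoc)
  then have "v x = v (x * inverse y) + v y" using v unfolding valuation_def by metis
  with g show ?thesis
    by (cases "v (x * inverse y)") (auto simp: zero_extended_def)
qed

lemma is_valuation_ring_val_ring:
  fixes v :: "'l::field \<Rightarrow> 'g::linordered_ab_group_add extended"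
  assumes v: "valuation v"
  shows "is_valuation_ring (val_ring v UNIV)"
proof -
  let ?R = "ring_of_type_algebra :: 'l ring"
  interpret R: ring ?R by (rule ring_from_type_algebra)
  have mult: "\<And>x y. v (x * y) = v x + v y" and add: "\<And>x y. min (v x) (v y) \<le> v (x + y)"
    using v unfolding valuation_def by auto
  have inv: "\<ominus>\<^bsub>?R\<^esub> x = - x" for x :: 'l
    by (rule R.minus_equality) (auto simp: ring_of_type_algebra_def)
  have m1: "v (-1) + v (-1) = 0"
    using mult[of "-1" "-1"] valuation_one[OF v] by simp
  have nonneg: "0 \<le> x + y" if "0 \<le> x" "0 \<le> y" for x y :: "'g extended"
    using add_mono[OF that] by simp
  have "0 \<le> v (-1)"
  proof (cases "v (-1)")
    case (Fin g)
    then have "g + g = 0" using m1 by (simp add: zero_extended_def)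
    then show ?thesis using Fin by (simp add: zero_extended_def)
  qed (use m1 in \<open>auto simp: zero_extended_def\<close>)
  then have neg: "0 \<le> v (- x)" if "0 \<le> v x" for x
    using mult[of "-1" x] that nonneg by simp
  have "subring (val_ring v UNIV) ?R"
    using neg nonneg
    by (intro R.subringI)
      (auto simp: ring_of_type_algebra_def[where ?'a = 'l] inv[unfolded ring_of_type_algebra_def]
        val_ring_def mult valuation_one[OF v] intro: order_trans[OF _ add])
  moreover have "x \<in> val_ring v UNIV \<or> inverse x \<in> val_ring v UNIV" if x: "x \<noteq> 0" for x
    using valuation_inverse_ge[OF v x, of 1] valuation_one[OF v]
    by (auto simp: val_ring_def)
  ultimately show ?thesis by (auto simp: is_valuation_ring_def)
qed

lemma val_ring_eq_iff_equivalent: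
  fixes v :: "'l::field \<Rightarrow> 'g::linordered_ab_group_add extended"
    and w :: "'l \<Rightarrow> 'h::linordered_ab_group_add extended"
  assumes v: "valuation v" and w: "valuation w"
  shows "val_ring v UNIV = val_ring w UNIV \<longleftrightarrow> (\<forall>x y. v y \<le> v x \<longleftrightarrow> w y \<le> w x)"
proof
  assume eq: "val_ring v UNIV = val_ring w UNIV"
  show "\<forall>x y. v y \<le> v x \<longleftrightarrow> w y \<le> w x"
  proof (intro allI)
    fix x y
    show "v y \<le> v x \<longleftrightarrow> w y \<le> w x"
    proof (cases "y = 0")
      case True
      then show ?thesis using v w unfolding valuation_def by (metis Pinf_le)
    next
      case False
      have "x * inverse y \<in> val_ring v UNIV \<longleftrightarrow> x * inverse y \<in> val_ring w UNIV"
        using eq by simp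
      then show ?thesis
        using valuation_inverse_ge[OF v False, of x] valuation_inverse_ge[OF w False, of x]
        by (simp add: val_ring_def)
    qed
  qed
next
  assume eq: "\<forall>x y. v y \<le> v x \<longleftrightarrow> w y \<le> w x"
  then have "0 \<le> v x \<longleftrightarrow> 0 \<le> w x" for x
    using valuation_one[OF v] valuation_one[OF w] by metis
  then show "val_ring v UNIV = val_ring w UNIV" by (simp add: val_ring_def)
qed

definition unibranched :: "('l::field \<Rightarrow> 'g::linordered_ab_group_add extended) \<Rightarrow> 'l set \<Rightarrow> bool"
  where "unibranched v K \<longleftrightarrow>
    (\<forall>R. is_valuation_ring R \<and> R \<inter> K = val_ring v K \<longrightarrow> R = val_ring v UNIV)"

definition finite_extension :: "'l::field set \<Rightarrow> bool"
  where "finite_extension K \<longleftrightarrow> ring.finite_dimension ring_of_type_algebra K UNIV"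

definition ext_degree :: "'l::field set \<Rightarrow> nat"
  where "ext_degree K = ring.dim ring_of_type_algebra K UNIV"

definition ramification_index ::
    "('l::field \<Rightarrow> 'g::linordered_ab_group_add extended) \<Rightarrow> 'l set \<Rightarrow> nat"
  where "ramification_index v K = card (cosets (value_group v UNIV) (value_group v K))"

definition inertia_degree ::
    "('l::field \<Rightarrow> 'g::linordered_ab_group_add extended) \<Rightarrow> 'l set \<Rightarrow> nat"
  where "inertia_degree v K =
    ring.dim (residue_field v UNIV) (residue_subfield v K) (carrier (residue_field v UNIV))"

definition res_char_exponent ::
    "('l::field \<Rightarrow> 'g::linordered_ab_group_add extended) \<Rightarrow> 'l set \<Rightarrow> nat"
  where "res_char_exponent v K =
    (if ring_char (residue_field v K) > 0 then ring_char (residue_field v K) else 1)"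

definition defect_extension ::
    "('l::field \<Rightarrow> 'g::linordered_ab_group_add extended) \<Rightarrow> 'l set \<Rightarrow> bool"
  where "defect_extension v K \<longleftrightarrow>
    finite_extension K \<and> unibranched v K \<and>
    (\<exists>\<nu>::nat. ext_degree K =
        res_char_exponent v K ^ \<nu> * ramification_index v K * inertia_degree v K \<and>
      res_char_exponent v K ^ \<nu> > 1)"


section \<open>Artin-Schreier extensions and independent defect\<close>

definition Gal :: "'l::field set \<Rightarrow> ('l \<Rightarrow> 'l) set"
  where "Gal K = {\<sigma>. bij \<sigma> \<and> (\<forall>x y. \<sigma> (x + y) = \<sigma> x + \<sigma> y) \<and>
    (\<forall>x y. \<sigma> (x * y) = \<sigma> x * \<sigma> y) \<and> (\<forall>x\<in>K. \<sigma> x = x)}"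

definition galois_extension :: "'l::field set \<Rightarrow> bool"
  where "galois_extension K \<longleftrightarrow> finite_extension K \<and> {x. \<forall>\<sigma>\<in>Gal K. \<sigma> x = x} = K"

definition wp :: "'l::field \<Rightarrow> 'l"
  where "wp x = x ^ CHAR('l) - x"

definition generates :: "'l::field set \<Rightarrow> 'l \<Rightarrow> bool"
  where "generates K x \<longleftrightarrow> generate_field ring_of_type_algebra (insert x K) = UNIV"

definition artin_schreier_extension :: "'l::field set \<Rightarrow> bool"
  where "artin_schreier_extension K \<longleftrightarrow>
    subfield K ring_of_type_algebra \<and> CHAR('l) > 0 \<and>
    galois_extension K \<and> ext_degree K = CHAR('l) \<and>
    (\<exists>x. wp x \<in> K \<and> generates K x)"

definition sigma_set ::
    "('l::field \<Rightarrow> 'g::linordered_ab_group_add extended) \<Rightarrow> ('l \<Rightarrow> 'l) \<Rightarrow> 'g extended set"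
  where "sigma_set v \<sigma> = {v ((\<sigma> b - b) / b) |b. b \<noteq> 0 \<and> \<sigma> b \<noteq> b}"

text \<open>
  For Galois defect extensions of prime degree, \<open>sigma_set v \<sigma>\<close> does not depend on the choice of
  \<open>\<sigma> \<noteq> id\<close>.
\<close>

definition independent_defect ::
    "('l::field \<Rightarrow> 'g::linordered_ab_group_add extended) \<Rightarrow> 'l set \<Rightarrow> bool"
  where "independent_defect v K \<longleftrightarrow>
    (\<exists>H. strongly_convex_subgroup H (value_group v UNIV) \<and>
      (\<forall>\<sigma>\<in>Gal K - {id}. sigma_set v \<sigma> = Fin ` elems_above (value_group v UNIV) H))"

end

theory Submission
  imports Defs "HOL-Algebra.Finite_Extensions"
begin

text \<open>
  Let \<open>S\<close> be the set of all \<open>- v (\<theta> - c)\<close> with \<open>c\<close> in \<open>K\<close>. An Artin-Schreier defect extension is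
  immediate: the factor \<open>p\<close> in the degree formula is used up by the defect, so ramification index and
  inertia degree are 1. Hence no \<open>c\<close> is a best approximation to \<open>\<theta>\<close>. If some \<open>v (\<theta> - c)\<close> were
  nonnegative, a better \<open>c\<close> would make it positive, and then so would be the value of
  \<open>\<sigma> \<theta> - \<theta>\<close>, because automorphisms preserve \<open>v\<close> in a unibranched extension; but this difference is a
  nonzero root of \<open>X\<^sup>p - X\<close> and has value 0. So \<open>S\<close> consists of positive elements, and it is a final
  segment of the value group. Since \<open>wp\<close> is additive and its linear term is negligible at elements of
  negative value, \<open>v (a - wp c) = p v (\<theta> - c)\<close>.

  The heart of the proof is that \<open>sigma_set v \<sigma>\<close> equals \<open>S\<close> for every nontrivial automorphism
  \<open>\<sigma>\<close> (lemma \<open>sigma_set_eq_distances\<close>). One inclusion comes from the elements \<open>\<theta> - c\<close>. For the other,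
  write \<open>b = g(\<theta>)\<close> with \<open>g\<close> of degree less than \<open>p\<close> and expand \<open>g\<close> at \<open>\<theta>\<close> with Taylor coefficients
  \<open>g\<^sub>l\<close>. Since \<open>\<sigma> \<theta> = \<theta> + i\<close> with \<open>v i = 0\<close>, the difference \<open>\<sigma> b - b\<close> is the sum of the
  \<open>g\<^sub>l i\<^sup>l\<close> with \<open>l > 0\<close>, so that it suffices to bound the values of these coefficients from below by
  \<open>v b - v (\<theta> - c)\<close> for some \<open>c\<close>.

  This bound is a form of a theorem of Kaplansky. For \<open>c\<close> sufficiently close to \<open>\<theta>\<close>, one of the linear
  functions \<open>v g\<^sub>l + l v (\<theta> - c)\<close> lies strictly below the others, so it is the value of \<open>g(c)\<close>; call
  its index \<open>l\<close> the slope of \<open>g\<close>. The bound holds if the slope is 0, and lemma \<open>slope_eq_0\<close> shows that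
  all nonzero polynomials over \<open>K\<close> of degree less than \<open>p\<close> have slope 0. Slopes are additive, and never exceed
  the degree. The slope of \<open>f\<close> is strictly smaller than its degree if the latter is positive and less
  than \<open>p\<close>, because the coefficient next to the leading one is a multiple of \<open>\<theta> - c\<close> for some \<open>c\<close> in
  \<open>K\<close>. But \<open>X\<^sup>p - X - a\<close> has slope \<open>p\<close>. Dividing it by \<open>f\<close> with remainder, the product \<open>q f\<close> has
  slope less than \<open>p\<close> and the remainder has slope 0 by induction, so the slope of \<open>q f\<close> and hence that
  of \<open>f\<close> must be 0.

  All characterizations of independent defect are then statements about the final segment \<open>S\<close> of an
  ordered abelian group (locale \<open>positive_final_segment\<close>). They rest on the fact that a convex subgroup
  \<open>H\<close> is strongly convex if and only if for every \<open>\<alpha>\<close> above \<open>H\<close> there is \<open>\<beta>\<close> above \<open>H\<close> with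
  \<open>\<beta> + \<beta> \<le> \<alpha>\<close>. For instance, if \<open>p S = S\<close>, the elements whose absolute value lies below \<open>S\<close> form such a subgroup.
\<close>

section \<open>Multiples in ordered abelian groups\<close>

lemma nmult_0 [simp]: "nmult 0 x = 0"
  by (simp add: nmult_def)

lemma nmult_Suc [simp]: "nmult (Suc n) x = nmult n x + x"
  by (simp add: nmult_def)

lemma nmult_plus: "nmult (m + n) x = nmult m x + nmult n x"
  by (induction n) (simp_all add: add.assoc)

lemma nmult_minus: "nmult n (- x) = - nmult n (x :: 'g::ab_group_add)"
  by (simp add: nmult_def sum_negf)

lemma nmult_Fin: "nmult n (Fin g) = Fin (nmult n (g :: 'g::comm_monoid_add))"
  by (induction n) (simp_all add: zero_extended_def)

lemma nmult_mono: "x \<le> y \<Longrightarrow> nmult n x \<le> nmult n (y :: 'g::linordered_ab_group_add)"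
  by (simp add: nmult_def sum_mono)

lemma nmult_strict_mono: "n > 0 \<Longrightarrow> x < y \<Longrightarrow> nmult n x < nmult n (y :: 'g::linordered_ab_group_add)"
  unfolding nmult_def by (rule sum_strict_mono) auto

lemma nmult_eq_iff: "n > 0 \<Longrightarrow> nmult n x = nmult n y \<longleftrightarrow> x = (y :: 'g::linordered_ab_group_add)"
  by (metis linorder_neq_iff nmult_strict_mono)

lemma nmult_zero [simp]: "nmult n (0 :: 'g::comm_monoid_add) = 0"
  by (simp add: nmult_def)

lemma nmult_ge_self: "n > 0 \<Longrightarrow> 0 \<le> x \<Longrightarrow> x \<le> nmult n (x :: 'g::linordered_ab_group_add)"
  using nmult_mono[of 0 x "n - 1"] by (cases n) (auto simp: add_increasing)

section \<open>Convex subgroups and final segments\<close>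

lemma add_subgroupD:
  assumes "add_subgroup H G"
  shows "H \<subseteq> G" "0 \<in> H" "x \<in> H \<Longrightarrow> y \<in> H \<Longrightarrow> x + y \<in> H" "x \<in> H \<Longrightarrow> - x \<in> H"
  using assms unfolding add_subgroup_def by blast+

lemma convex_subgroupD:
  assumes "convex_subgroup H G"
  shows "add_subgroup H G"
    and "x \<in> H \<Longrightarrow> z \<in> H \<Longrightarrow> y \<in> G \<Longrightarrow> x \<le> y \<Longrightarrow> y \<le> z \<Longrightarrow> y \<in> H"
  using assms unfolding convex_subgroup_def by blast+

lemma nmult_in_add_subgroup: "add_subgroup G G' \<Longrightarrow> x \<in> G \<Longrightarrow> nmult n x \<in> G"
  by (induction n) (simp_all add: add_subgroupD)

text \<open>
  The reason is that \<open>H\<close> contains all multiples of its elements.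
\<close>

lemma nmult_above_iff:
  assumes H: "convex_subgroup H G" and x: "x \<in> G" and n: "n > 0"
  shows "(\<forall>h\<in>H. h < nmult n x) \<longleftrightarrow> (\<forall>h\<in>H. h < x)"
proof
  assume L: "\<forall>h\<in>H. h < nmult n x"
  show "\<forall>h\<in>H. h < x"
  proof (rule ballI, rule ccontr)
    fix h assume h: "h \<in> H" "\<not> h < x"
    then have "nmult n x \<le> nmult n h" by (intro nmult_mono) simp
    moreover have "nmult n h \<in> H"
      using nmult_in_add_subgroup[OF convex_subgroupD(1)[OF H] h(1)] .
    ultimately show False using L by fastforce
  qed
next
  assume R: "\<forall>h\<in>H. h < x"
  then have "0 < x" using add_subgroupD(2)[OF convex_subgroupD(1)[OF H]] by auto
  then have "x \<le> nmult n x" using n by (intro nmult_ge_self) auto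
  then show "\<forall>h\<in>H. h < nmult n x" using R by fastforce
qed

lemma elems_above_nmult:
  assumes "convex_subgroup H G" "n > 0"
  shows "elems_above (nmult n ` G) H = nmult n ` elems_above G H"
  using nmult_above_iff[OF assms(1) _ assms(2)] by (auto simp: elems_above_def)

text \<open>
  A coset of a convex subgroup other than the subgroup itself lies entirely above or entirely below it,
  so the positive cosets are those of the elements above \<open>H\<close>. This replaces the ordered quotient group by
  conditions on elements.
\<close>

lemma positive_cosets_eq:
  assumes H: "convex_subgroup H G"
  shows "positive_cosets G H = (\<lambda>\<alpha>. (\<lambda>h. \<alpha> + h) ` H) ` elems_above G H"
proof (rule subset_antisym; rule subsetI)
  fix A assume "A \<in> positive_cosets G H"
  then have "A \<in> cosets G H" and ne: "A \<noteq> H" and le: "coset_le H A"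
    by (auto simp: positive_cosets_def)
  then obtain \<alpha> where \<alpha>: "\<alpha> \<in> G" "A = (\<lambda>h. \<alpha> + h) ` H"
    unfolding cosets_def by (elim imageE)
  obtain x y where xy: "x \<in> H" "y \<in> H" "x \<le> \<alpha> + y"
    using le unfolding coset_le_def \<alpha>(2) by blast
  have notin: "\<alpha> \<notin> H"
  proof
    assume a: "\<alpha> \<in> H"
    have "A = H"
    proof
      show "A \<subseteq> H" using a \<alpha>(2) add_subgroupD(3)[OF convex_subgroupD(1)[OF H]] by auto
      show "H \<subseteq> A"
      proof
        fix h assume "h \<in> H"
        then have "- \<alpha> + h \<in> H" using a add_subgroupD(3,4)[OF convex_subgroupD(1)[OF H]] by blast
        moreover have "h = \<alpha> + (- \<alpha> + h)" by simp
        ultimately show "h \<in> A" unfolding \<alpha>(2) by (rule rev_image_eqI)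
      qed
    qed
    then show False using ne by simp
  qed
  have "h < \<alpha>" if h: "h \<in> H" for h
  proof (rule ccontr)
    assume "\<not> h < \<alpha>"
    moreover have "x + - y \<le> \<alpha>" using xy(3) by (simp add: algebra_simps)
    moreover have "x + - y \<in> H" using xy add_subgroupD(3,4)[OF convex_subgroupD(1)[OF H]] by blast
    ultimately show False
      using notin convex_subgroupD(2)[OF H _ h \<alpha>(1)] by auto
  qed
  then show "A \<in> (\<lambda>\<alpha>. (\<lambda>h. \<alpha> + h) ` H) ` elems_above G H"
    using \<alpha> by (auto simp: elems_above_def)
next
  fix A assume "A \<in> (\<lambda>\<alpha>. (\<lambda>h. \<alpha> + h) ` H) ` elems_above G H"
  then obtain \<alpha> where \<alpha>: "\<alpha> \<in> G" "\<And>h. h \<in> H \<Longrightarrow> h < \<alpha>" "A = (\<lambda>h. \<alpha> + h) ` H"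
    by (auto simp: elems_above_def)
  have 0: "0 \<in> H" by (rule add_subgroupD(2)[OF convex_subgroupD(1)[OF H]])
  then have mem: "\<alpha> \<in> A" unfolding \<alpha>(3) by force
  then have "A \<noteq> H" using \<alpha>(2) by blast
  moreover have "coset_le H A"
    unfolding coset_le_def using 0 mem \<alpha>(2)[OF 0] less_imp_le by blast
  ultimately show "A \<in> positive_cosets G H"
    using \<alpha> by (auto simp: positive_cosets_def cosets_def)
qed

text \<open>
  In the quotient by \<open>H\<close>, if \<open>\<alpha>\<close> is positive but not smallest, there is \<open>\<beta>\<close> strictly between 0 and
  \<open>\<alpha>\<close>, and the smaller one of \<open>\<beta>\<close> and \<open>\<alpha> - \<beta>\<close> is at most half of \<open>\<alpha>\<close>. The right-hand side can be
  iterated, and does not mention cosets.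
\<close>

lemma strongly_convex_subgroup_iff:
  assumes G: "add_subgroup G G'"
  shows "strongly_convex_subgroup H G \<longleftrightarrow> convex_subgroup H G \<and> H \<noteq> G \<and>
    (\<forall>\<alpha>\<in>elems_above G H. \<exists>\<beta>\<in>elems_above G H. \<beta> + \<beta> \<le> \<alpha>)"
proof (cases "convex_subgroup H G")
  case H: True
  note HD = add_subgroupD[OF convex_subgroupD(1)[OF H]]
  let ?c = "\<lambda>\<alpha>. (\<lambda>h. \<alpha> + h) ` H" and ?E = "elems_above G H"
  have le: "coset_le (?c \<alpha>) (?c \<beta>) \<longleftrightarrow> (\<exists>h\<in>H. \<alpha> \<le> \<beta> + h)" for \<alpha> \<beta>
  proof
    assume "coset_le (?c \<alpha>) (?c \<beta>)"
    then obtain h k where "h \<in> H" "k \<in> H" "\<alpha> + h \<le> \<beta> + k" by (auto simp: coset_le_def)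
    then have "k + - h \<in> H" "\<alpha> \<le> \<beta> + (k + - h)"
      using HD(3,4) by (blast, simp add: algebra_simps)
    then show "\<exists>h\<in>H. \<alpha> \<le> \<beta> + h" by blast
  next
    assume "\<exists>h\<in>H. \<alpha> \<le> \<beta> + h"
    then obtain h where h: "h \<in> H" "\<alpha> + 0 \<le> \<beta> + h" by auto
    then show "coset_le (?c \<alpha>) (?c \<beta>)" unfolding coset_le_def using HD(2) by blast
  qed
  have "(\<exists>A\<in>positive_cosets G H. \<forall>B\<in>positive_cosets G H. coset_le A B) \<longleftrightarrow>
      (\<exists>\<alpha>\<in>?E. \<forall>\<beta>\<in>?E. \<exists>h\<in>H. \<alpha> \<le> \<beta> + h)"
    by (simp add: positive_cosets_eq[OF H] le)
  also have "\<dots> \<longleftrightarrow> \<not> (\<forall>\<alpha>\<in>?E. \<exists>\<beta>\<in>?E. \<forall>h\<in>H. \<beta> + h < \<alpha>)"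
    by (meson linorder_not_le)
  also have "(\<forall>\<alpha>\<in>?E. \<exists>\<beta>\<in>?E. \<forall>h\<in>H. \<beta> + h < \<alpha>) \<longleftrightarrow> (\<forall>\<alpha>\<in>?E. \<exists>\<beta>\<in>?E. \<beta> + \<beta> \<le> \<alpha>)"
  proof (intro iffI ballI)
    fix \<alpha> assume L: "\<forall>\<alpha>\<in>?E. \<exists>\<beta>\<in>?E. \<forall>h\<in>H. \<beta> + h < \<alpha>" and \<alpha>: "\<alpha> \<in> ?E"
    then obtain \<beta> where \<beta>: "\<beta> \<in> ?E" "\<And>h. h \<in> H \<Longrightarrow> \<beta> + h < \<alpha>" by blast
    have "\<alpha> - \<beta> \<in> G"
      using add_subgroupD(3)[OF G _ add_subgroupD(4)[OF G], of \<alpha> \<beta>] \<alpha> \<beta>(1)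
      by (simp add: elems_above_def)
    then have \<gamma>: "\<alpha> - \<beta> \<in> ?E" using \<beta>(2) by (auto simp: elems_above_def less_diff_eq add.commute)
    show "\<exists>\<beta>\<in>?E. \<beta> + \<beta> \<le> \<alpha>"
    proof (cases "\<beta> \<le> \<alpha> - \<beta>")
      case True
      then show ?thesis using \<beta>(1) by (auto simp: le_diff_eq)
    next
      case False
      then have "\<alpha> - \<beta> + (\<alpha> - \<beta>) \<le> \<beta> + (\<alpha> - \<beta>)" by (intro add_right_mono) simp
      then show ?thesis using \<gamma> by (intro bexI[of _ "\<alpha> - \<beta>"]) auto
    qed
  next
    fix \<alpha> assume R: "\<forall>\<alpha>\<in>?E. \<exists>\<beta>\<in>?E. \<beta> + \<beta> \<le> \<alpha>" and \<alpha>: "\<alpha> \<in> ?E"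
    then obtain \<beta> where \<beta>: "\<beta> \<in> ?E" "\<beta> + \<beta> \<le> \<alpha>" by blast
    have "\<beta> + h < \<alpha>" if "h \<in> H" for h
      using \<beta> that by (intro less_le_trans[OF _ \<beta>(2)]) (auto simp: elems_above_def)
    then show "\<exists>\<beta>\<in>?E. \<forall>h\<in>H. \<beta> + h < \<alpha>" using \<beta>(1) by blast
  qed
  finally show ?thesis using H by (simp add: strongly_convex_subgroup_def)
qed (simp add: strongly_convex_subgroup_def)

lemma strongly_convex_subgroup_nmult:
  assumes G: "add_subgroup G G'" and H: "strongly_convex_subgroup H G"
    and \<alpha>: "\<alpha> \<in> elems_above G H"
  shows "\<exists>\<beta>\<in>elems_above G H. nmult n \<beta> \<le> \<alpha>"
proof -
  have convex: "convex_subgroup H G"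
    and halve: "\<And>\<alpha>. \<alpha> \<in> elems_above G H \<Longrightarrow> \<exists>\<beta>\<in>elems_above G H. \<beta> + \<beta> \<le> \<alpha>"
    using H by (auto simp: strongly_convex_subgroup_iff[OF G])
  have pos: "0 < \<alpha>" if "\<alpha> \<in> elems_above G H" for \<alpha>
    using that add_subgroupD(2)[OF convex_subgroupD(1)[OF convex]] by (auto simp: elems_above_def)
  have "\<exists>\<beta>\<in>elems_above G H. \<beta> \<le> \<alpha> \<and> nmult n \<beta> \<le> \<alpha>"
    using \<alpha>
  proof (induction n arbitrary: \<alpha>)
    case 0
    then show ?case using pos by (auto intro!: bexI[of _ \<alpha>] less_imp_le)
  next
    case (Suc n)
    obtain \<beta> where \<beta>: "\<beta> \<in> elems_above G H" "\<beta> + \<beta> \<le> \<alpha>" using halve[OF Suc.prems] by blast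
    obtain \<gamma> where \<gamma>: "\<gamma> \<in> elems_above G H" "\<gamma> \<le> \<beta>" "nmult n \<gamma> \<le> \<beta>" using Suc.IH[OF \<beta>(1)] by blast
    have "nmult (Suc n) \<gamma> \<le> \<beta> + \<beta>" using \<gamma> by (simp add: add_mono)
    moreover have "\<gamma> \<le> \<beta> + \<beta>" using \<gamma>(2) pos[OF \<beta>(1)] by (simp add: add_increasing2 less_imp_le)
    ultimately show ?case using \<gamma>(1) \<beta>(2) by (auto intro: order_trans)
  qed
  then show ?thesis by blast
qed

text \<open>
  In the application, \<open>S\<close> is the set of negatives of the values \<open>v (\<theta> - c)\<close>, and the condition
  \<open>above_strongly_convex\<close> is independence of the defect.
\<close>

locale positive_final_segment =
  fixes G S :: "'g::linordered_ab_group_add set" and p :: nat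
  assumes G: "add_subgroup G G"
    and S_subset: "S \<subseteq> G" and S_nonempty: "S \<noteq> {}"
    and S_pos: "s \<in> S \<Longrightarrow> 0 < s"
    and S_upward: "s \<in> S \<Longrightarrow> g \<in> G \<Longrightarrow> s \<le> g \<Longrightarrow> g \<in> S"
    and p_gt_1: "p > 1"
begin

definition above_strongly_convex :: bool
  where "above_strongly_convex \<longleftrightarrow> (\<exists>H. strongly_convex_subgroup H G \<and> S = elems_above G H)"

lemma nmult_pos: "s \<in> S \<Longrightarrow> 0 < nmult p s"
  using S_pos[of s] p_gt_1 nmult_strict_mono[of p 0 s] by simp

lemma le_nmult: "s \<in> S \<Longrightarrow> s \<le> nmult p s"
  using S_pos[of s] p_gt_1 by (intro nmult_ge_self) auto

lemma double_le_nmult: "0 \<le> s \<Longrightarrow> s + s \<le> nmult p (s :: 'g)"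
proof -
  assume s: "0 \<le> s"
  obtain q where "p = 2 + q" using p_gt_1 le_Suc_ex[of 2 p] by auto
  then show ?thesis using s nmult_mono[of 0 s q] by (simp add: nmult_plus numeral_2_eq_2)
qed

lemma scaled_iff:
  "above_strongly_convex \<longleftrightarrow>
    (\<exists>H. strongly_convex_subgroup H G \<and> nmult p ` S = elems_above (nmult p ` G) H)"
proof -
  have "nmult p ` S = elems_above (nmult p ` G) H \<longleftrightarrow> S = elems_above G H"
    if "strongly_convex_subgroup H G" for H
  proof -
    have "inj (nmult p :: 'g \<Rightarrow> 'g)" using p_gt_1 by (auto simp: inj_def nmult_eq_iff)
    moreover have "convex_subgroup H G" using that by (simp add: strongly_convex_subgroup_def)
    ultimately show ?thesis using p_gt_1 by (simp add: elems_above_nmult inj_image_eq_iff)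
  qed
  then show ?thesis unfolding above_strongly_convex_def by blast
qed

text \<open>
  The multiples by \<open>p\<close> in the last condition do no harm: if \<open>S\<close> is the set of elements above \<open>H\<close>, then
  each \<open>\<alpha>\<close> above \<open>H\<close> admits \<open>s\<close> above \<open>H\<close> with \<open>p s \<le> \<alpha>\<close> by strong convexity; conversely,
  \<open>s \<le> p s \<le> \<alpha>\<close> forces \<open>\<alpha>\<close> into the final segment.
\<close>

lemma cofinal_iff:
  "above_strongly_convex \<longleftrightarrow>
    (\<exists>H. strongly_convex_subgroup H G \<and> (\<forall>s\<in>S. \<forall>h\<in>H. - nmult p s < h) \<and>
      (\<forall>\<alpha>\<in>elems_above G H. \<exists>s\<in>S. nmult p s \<le> \<alpha>))"
proof -
  have "S = elems_above G H \<longleftrightarrow> (\<forall>s\<in>S. \<forall>h\<in>H. - nmult p s < h) \<and>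
      (\<forall>\<alpha>\<in>elems_above G H. \<exists>s\<in>S. nmult p s \<le> \<alpha>)"
    if H: "strongly_convex_subgroup H G" for H
  proof -
    have convex: "convex_subgroup H G" using H by (simp add: strongly_convex_subgroup_def)
    note HD = add_subgroupD[OF convex_subgroupD(1)[OF convex]]
    have "(\<forall>h\<in>H. - nmult p s < h) \<longleftrightarrow> s \<in> elems_above G H" if s: "s \<in> S" for s
    proof -
      have "(\<forall>h\<in>H. - nmult p s < h) \<longleftrightarrow> (\<forall>h\<in>H. h < nmult p s)"
      proof (intro iffI ballI)
        show "h < nmult p s" if "\<forall>h\<in>H. - nmult p s < h" "h \<in> H" for h
          using that(1) HD(4)[OF that(2)] by fastforce
        show "- nmult p s < h" if "\<forall>h\<in>H. h < nmult p s" "h \<in> H" for h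
          using that(1) HD(4)[OF that(2)] by (fastforce simp: minus_less_iff)
      qed
      then show ?thesis
        using nmult_above_iff[OF convex, of s p] s S_subset p_gt_1 by (auto simp: elems_above_def)
    qed
    then have "(\<forall>s\<in>S. \<forall>h\<in>H. - nmult p s < h) \<longleftrightarrow> S \<subseteq> elems_above G H" by blast
    moreover have "(\<forall>\<alpha>\<in>elems_above G H. \<exists>s\<in>S. nmult p s \<le> \<alpha>) \<longleftrightarrow> elems_above G H \<subseteq> S"
    proof
      assume L: "\<forall>\<alpha>\<in>elems_above G H. \<exists>s\<in>S. nmult p s \<le> \<alpha>"
      show "elems_above G H \<subseteq> S"
      proof
        fix \<alpha> assume \<alpha>: "\<alpha> \<in> elems_above G H"
        then obtain s where s: "s \<in> S" "nmult p s \<le> \<alpha>" using L by blast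
        have "\<alpha> \<in> G" using \<alpha> by (simp add: elems_above_def)
        then show "\<alpha> \<in> S"
          using S_upward[OF s(1)] order_trans[OF le_nmult[OF s(1)] s(2)] by blast
      qed
    next
      assume "elems_above G H \<subseteq> S"
      then show "\<forall>\<alpha>\<in>elems_above G H. \<exists>s\<in>S. nmult p s \<le> \<alpha>"
        using strongly_convex_subgroup_nmult[OF G H] by blast
    qed
    ultimately show ?thesis by blast
  qed
  then show ?thesis unfolding above_strongly_convex_def by blast
qed

text \<open>
  Divisibility is what makes \<open>p S\<close> exhaust the elements above \<open>H\<close>. In the other direction, the existence
  of \<open>t\<close> in \<open>S\<close> with \<open>s = p t\<close> yields both that the elements below \<open>S\<close> in absolute value form a
  subgroup and that it is strongly convex.
\<close>

lemma divisible_iff: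
  assumes div: "n_divisible p G"
  shows "above_strongly_convex \<longleftrightarrow> nmult p ` S = S"
proof
  assume above_strongly_convex
  then obtain H where H: "strongly_convex_subgroup H G" "S = elems_above G H"
    by (auto simp: above_strongly_convex_def)
  have "nmult p ` G = G"
  proof
    show "nmult p ` G \<subseteq> G" using nmult_in_add_subgroup[OF G] by blast
    show "G \<subseteq> nmult p ` G" using div by (force simp: n_divisible_def)
  qed
  then show "nmult p ` S = S"
    using elems_above_nmult[of H G p] H p_gt_1 by (simp add: strongly_convex_subgroup_def)
next
  assume S: "nmult p ` S = S"
  \<comment> \<open>The largest convex subgroup below \<open>S\<close>: every \<open>s\<close> in \<open>S\<close> is \<open>p t\<close>, hence at least \<open>t + t\<close>, with
    \<open>t\<close> in \<open>S\<close>, and this bounds sums of two elements of \<open>H\<close>.\<close>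
  define H where "H = {h\<in>G. \<forall>s\<in>S. h < s \<and> - h < s}"
  have H_G: "H \<subseteq> G" and zero: "0 \<in> H"
    using add_subgroupD(2)[OF G] S_pos by (auto simp: H_def)
  have add: "x + y \<in> H" if "x \<in> H" "y \<in> H" for x y
  proof -
    have "x + y < s \<and> - (x + y) < s" if s: "s \<in> S" for s
    proof -
      obtain t where t: "t \<in> S" "s = nmult p t" using S s by blast
      have le: "t + t \<le> s" using double_le_nmult S_pos t less_imp_le by blast
      have "x < t" "y < t" "- x < t" "- y < t"
        using \<open>x \<in> H\<close> \<open>y \<in> H\<close> t(1) by (simp_all add: H_def)
      then have "x + y < t + t" "- x + - y < t + t" by (intro add_strict_mono; simp)+
      then show ?thesis using less_le_trans[OF _ le] by simp
    qed
    then show ?thesis using that add_subgroupD(3)[OF G] by (simp add: H_def)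
  qed
  have convex: "convex_subgroup H G"
    unfolding convex_subgroup_def add_subgroup_def
  proof (intro conjI ballI impI)
    show "- x \<in> H" if "x \<in> H" for x using that add_subgroupD(4)[OF G] by (simp add: H_def)
    show "y \<in> H" if "x \<in> H" "z \<in> H" "y \<in> G" "x \<le> y \<and> y \<le> z" for x y z
      using that by (auto simp: H_def intro: le_less_trans order_trans[of "- y" "- x"])
        (meson le_less_trans neg_le_iff_le)
  qed (use H_G zero add in auto)
  have "H \<noteq> G" using S_nonempty S_subset by (auto simp: H_def)
  have eq: "elems_above G H = S"
  proof
    show "S \<subseteq> elems_above G H" using S_subset by (auto simp: elems_above_def H_def)
    show "elems_above G H \<subseteq> S"
    proof (rule subsetI, rule ccontr)
      fix \<alpha> assume \<alpha>: "\<alpha> \<in> elems_above G H" "\<alpha> \<notin> S"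
      then have "\<alpha> \<in> G" "0 < \<alpha>" using zero by (auto simp: elems_above_def)
      have "\<alpha> < s \<and> - \<alpha> < s" if "s \<in> S" for s
      proof
        show "\<alpha> < s" using S_upward[OF that \<open>\<alpha> \<in> G\<close>] \<alpha>(2) by (auto simp: not_le[symmetric])
        then show "- \<alpha> < s" using \<open>0 < \<alpha>\<close> by (metis less_trans neg_less_0_iff_less)
      qed
      then have "\<alpha> \<in> H" using \<open>\<alpha> \<in> G\<close> by (auto simp: H_def)
      then show False using \<alpha>(1) by (auto simp: elems_above_def)
    qed
  qed
  have "\<exists>\<beta>\<in>S. \<beta> + \<beta> \<le> \<alpha>" if "\<alpha> \<in> S" for \<alpha>
    using that S double_le_nmult S_pos by (metis imageE less_imp_le)
  then have "strongly_convex_subgroup H G"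
    using convex \<open>H \<noteq> G\<close> by (simp add: strongly_convex_subgroup_iff[OF G] eq)
  then show above_strongly_convex using eq by (auto simp: above_strongly_convex_def)
qed

text \<open>
  In rank one, the only candidate for \<open>H\<close> is the zero subgroup. It is strongly convex as soon as \<open>S\<close>
  contains arbitrarily small elements, since \<open>s + s \<le> p s\<close>.
\<close>

lemma rank_one_iff:
  assumes "rank_one G"
  shows "above_strongly_convex \<longleftrightarrow>
      (\<exists>H. strongly_convex_subgroup H G \<and> (\<forall>\<alpha>\<in>elems_above G H. \<exists>s\<in>S. nmult p s \<le> \<alpha>))"
    and "(\<exists>H. strongly_convex_subgroup H G \<and> (\<forall>\<alpha>\<in>elems_above G H. \<exists>s\<in>S. nmult p s \<le> \<alpha>)) \<longleftrightarrow>
      (\<forall>\<alpha>\<in>G. 0 < \<alpha> \<longrightarrow> (\<exists>s\<in>S. nmult p s \<le> \<alpha>))"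
proof -
  have zero: "convex_subgroup {0} G" "{0} \<noteq> G"
    and only: "\<And>H. convex_subgroup H G \<Longrightarrow> H \<noteq> G \<Longrightarrow> H = {0}"
    using assms unfolding rank_one_def by blast+
  have sc: "strongly_convex_subgroup H G \<longleftrightarrow> H = {0} \<and> strongly_convex_subgroup {0} G" for H
    using only unfolding strongly_convex_subgroup_def by blast
  have E: "elems_above G {0} = {\<alpha>\<in>G. 0 < \<alpha>}" by (auto simp: elems_above_def)
  show "above_strongly_convex \<longleftrightarrow>
      (\<exists>H. strongly_convex_subgroup H G \<and> (\<forall>\<alpha>\<in>elems_above G H. \<exists>s\<in>S. nmult p s \<le> \<alpha>))"
    unfolding cofinal_iff using sc nmult_pos
    by (metis neg_less_0_iff_less singletonD)
  show "(\<exists>H. strongly_convex_subgroup H G \<and> (\<forall>\<alpha>\<in>elems_above G H. \<exists>s\<in>S. nmult p s \<le> \<alpha>)) \<longleftrightarrow>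
      (\<forall>\<alpha>\<in>G. 0 < \<alpha> \<longrightarrow> (\<exists>s\<in>S. nmult p s \<le> \<alpha>))" (is "?L \<longleftrightarrow> ?R")
  proof
    assume ?L
    then obtain H where H: "strongly_convex_subgroup H G" "\<forall>\<alpha>\<in>elems_above G H. \<exists>s\<in>S. nmult p s \<le> \<alpha>"
      by blast
    then have "H = {0}" using sc by blast
    then show ?R using H(2) by (simp add: E)
  next
    assume R: ?R
    have "\<exists>\<beta>\<in>elems_above G {0}. \<beta> + \<beta> \<le> \<alpha>" if "\<alpha> \<in> elems_above G {0}" for \<alpha>
    proof -
      obtain s where s: "s \<in> S" "nmult p s \<le> \<alpha>" using R \<open>\<alpha> \<in> elems_above G {0}\<close> by (auto simp: E)
      then have "s + s \<le> \<alpha>" using double_le_nmult[of s] S_pos[of s] by (meson less_imp_le order_trans)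
      then show ?thesis using s S_pos S_subset by (auto simp: E)
    qed
    then have "strongly_convex_subgroup {0} G" using zero by (simp add: strongly_convex_subgroup_iff[OF G])
    then show ?L using R by (intro exI[of _ "{0}"]) (simp add: E)
  qed
qed

end

section \<open>Values and subfields\<close>

locale krull_valuation =
  fixes v :: "'l::field \<Rightarrow> 'g::linordered_ab_group_add extended"
  assumes valuation: "valuation v"
begin

text \<open>
  Away from 0, \<open>v\<close> takes its values in the group, where subtraction is available; \<open>val\<close> has the junk value
  0 at 0.
\<close>

definition val :: "'l \<Rightarrow> 'g"
  where "val x = (case v x of Fin g \<Rightarrow> g | _ \<Rightarrow> 0)"

lemma v_0 [simp]: "v 0 = \<infinity>"
  using valuation by (simp add: valuation_def)

lemma v_eq_Fin: "x \<noteq> 0 \<Longrightarrow> v x = Fin (val x)"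
  using valuation by (cases "v x") (auto simp: valuation_def val_def)

lemma v_mult: "v (x * y) = v x + v y"
  using valuation by (simp add: valuation_def)

lemma v_1 [simp]: "v 1 = 0"
  by (rule valuation_one[OF valuation])

lemma val_mult: "x \<noteq> 0 \<Longrightarrow> y \<noteq> 0 \<Longrightarrow> val (x * y) = val x + val y"
  using v_mult[of x y] by (simp add: v_eq_Fin)

lemma val_1 [simp]: "val 1 = 0"
  by (simp add: val_def zero_extended_def)

lemma val_power: "x \<noteq> 0 \<Longrightarrow> val (x ^ n) = nmult n (val x)"
  by (induction n) (simp_all add: val_mult add.commute)

lemma v_power: "x \<noteq> 0 \<Longrightarrow> v (x ^ n) = Fin (nmult n (val x))"
  by (simp add: v_eq_Fin val_power)

lemma val_inverse: "x \<noteq> 0 \<Longrightarrow> val (inverse x) = - val x"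
  using val_mult[of x "inverse x"] by (simp add: eq_neg_iff_add_eq_0 add.commute)

lemma val_divide: "x \<noteq> 0 \<Longrightarrow> y \<noteq> 0 \<Longrightarrow> val (x / y) = val x - val y"
  by (simp add: divide_inverse val_mult val_inverse)

text \<open>
  Ordered groups are torsion free. This evaluates \<open>v\<close> at roots of unity, such as \<open>-1\<close> and the nonzero
  elements of the prime field.
\<close>

lemma val_eq_0_of_equal_powers: "x \<noteq> 0 \<Longrightarrow> x ^ n = x ^ m \<Longrightarrow> n < m \<Longrightarrow> val x = 0"
proof -
  assume x: "x \<noteq> 0" "x ^ n = x ^ m" and nm: "n < m"
  obtain d where d: "m = n + d" "d > 0"
    using nm by (metis less_imp_add_positive)
  have "nmult n (val x) = nmult n (val x) + nmult d (val x)"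
    using x by (metis val_power d(1) nmult_plus)
  then have "nmult d (val x) = nmult d 0" by simp
  then show ?thesis using d(2) by (simp only: nmult_eq_iff)
qed

lemma v_minus [simp]: "v (- x) = v x"
proof (cases "x = 0")
  case False
  have "val (-1) = 0" using val_eq_0_of_equal_powers[of "-1" 0 2] by simp
  then have "val (- x) = val x" using False val_mult[of "-1" x] by simp
  then show ?thesis using False by (simp add: v_eq_Fin)
qed simp

lemma v_diff_commute: "v (x - y) = v (y - x)"
  using v_minus[of "x - y"] by simp

lemma v_add: "min (v x) (v y) \<le> v (x + y)"
  using valuation by (simp add: valuation_def)

lemma v_add_greater: "\<gamma> < v x \<Longrightarrow> \<gamma> < v y \<Longrightarrow> \<gamma> < v (x + y)"
  using v_add[of x y] by (auto simp: min_def split: if_splits)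

lemma v_diff_greater: "\<gamma> < v x \<Longrightarrow> \<gamma> < v y \<Longrightarrow> \<gamma> < v (x - y)"
  using v_add_greater[of \<gamma> x "- y"] by simp

text \<open>
  The ultrametric inequality is strict unless the minimum is attained twice; otherwise
  \<open>x = (x + y) - y\<close> would have a value greater than \<open>v x\<close>.
\<close>

lemma v_add_eq:
  assumes "v x < v y" shows "v (x + y) = v x"
proof (rule antisym)
  show "v x \<le> v (x + y)" using v_add[of x y] assms by (simp add: min_def less_imp_le)
  show "v (x + y) \<le> v x"
  proof (rule ccontr)
    assume "\<not> v (x + y) \<le> v x"
    then have "v x < v (x + y - y)" using assms by (intro v_diff_greater) auto
    then show False by simp
  qed
qed

lemma v_diff_eq: "v x < v y \<Longrightarrow> v (x - y) = v x"
  using v_add_eq[of x "- y"] by simp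

lemma v_sum_greater:
  assumes "finite I" "\<And>i. i \<in> I \<Longrightarrow> Fin \<gamma> < v (f i)"
  shows "Fin \<gamma> < v (sum f I)"
  using assms by (induction I rule: finite_induct) (auto intro: v_add_greater)

lemma v_sum_strict_min:
  assumes "finite I" "k \<in> I" "v (f k) = Fin \<gamma>" "\<And>i. i \<in> I \<Longrightarrow> i \<noteq> k \<Longrightarrow> Fin \<gamma> < v (f i)"
  shows "v (sum f I) = Fin \<gamma>"
proof -
  have "Fin \<gamma> < v (sum f (I - {k}))"
    using assms by (intro v_sum_greater) auto
  then show ?thesis
    using v_add_eq[of "f k"] assms(3) by (simp add: sum.remove[OF assms(1,2)])
qed

end

lemma
  fixes K :: "'l::field set"
  assumes "subfield K ring_of_type_algebra"
  shows subfield_0: "0 \<in> K" and subfield_1: "1 \<in> K"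
    and subfield_add: "x \<in> K \<Longrightarrow> y \<in> K \<Longrightarrow> x + y \<in> K"
    and subfield_mult: "x \<in> K \<Longrightarrow> y \<in> K \<Longrightarrow> x * y \<in> K"
    and subfield_uminus: "x \<in> K \<Longrightarrow> - x \<in> K"
    and subfield_inverse: "x \<in> K \<Longrightarrow> inverse x \<in> K"
proof -
  let ?R = "ring_of_type_algebra :: 'l ring"
  interpret R: field ?R by (rule field_from_type_algebra)
  have inv: "\<ominus>\<^bsub>?R\<^esub> x = - x" for x :: 'l
    by (rule R.minus_equality) (auto simp: ring_of_type_algebra_def)
  note E = subringE[OF subfieldE(1)[OF assms]]
  show z: "0 \<in> K" "1 \<in> K" using E(2,3) by (simp_all add: ring_of_type_algebra_def)
  show "x \<in> K \<Longrightarrow> y \<in> K \<Longrightarrow> x + y \<in> K" using E(7)[of x y] by (simp add: ring_of_type_algebra_def)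
  show "x \<in> K \<Longrightarrow> y \<in> K \<Longrightarrow> x * y \<in> K" using E(6)[of x y] by (simp add: ring_of_type_algebra_def)
  show "x \<in> K \<Longrightarrow> - x \<in> K" using E(5)[of x] by (simp add: inv)
  show "inverse x \<in> K" if x: "x \<in> K"
  proof (cases "x = 0")
    case False
    then have "inv\<^bsub>?R\<^esub> x \<in> K"
      using R.subfield_m_inv(1)[OF assms, of x] x by (simp add: ring_of_type_algebra_def)
    moreover have "inv\<^bsub>?R\<^esub> x = inverse x"
      by (rule R.comm_inv_char) (use False in \<open>auto simp: ring_of_type_algebra_def\<close>)
    ultimately show ?thesis by simp
  qed (use z in simp)
qed

text \<open>
  By Frobenius, elements of the prime field satisfy \<open>n\<^sup>p = n\<close>.
\<close>

lemma (in krull_valuation) val_of_nat: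
  fixes n :: nat
  assumes p: "CHAR('l) = p" "p > 1" and n: "(of_nat n :: 'l) \<noteq> 0"
  shows "val (of_nat n :: 'l) = 0"
proof -
  have "prime CHAR('l)" using p prime_CHAR_semidom[where ?'a = 'l] by simp
  note frobenius = freshmans_dream[where ?'a = 'l, OF this refl, unfolded p(1)]
  have "(of_nat n :: 'l) ^ p = of_nat n"
  proof (induction n)
    case 0
    show ?case using p(2) by simp
  next
    case (Suc n)
    show ?case unfolding of_nat_Suc frobenius Suc.IH by simp
  qed
  then show ?thesis using val_eq_0_of_equal_powers[OF n, of 1 p] p(2) by (metis power_one_right)
qed

context krull_valuation
begin

lemma v_poly_ge:
  assumes "\<And>l. \<gamma> \<le> v (Polynomial.coeff h l)" and x: "v x = 0"
  shows "\<gamma> \<le> v (poly h x)"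
  using assms(1)
proof (induction h)
  case (pCons a h)
  have "\<gamma> \<le> v a" using pCons.prems[of 0] by simp
  moreover have "\<gamma> \<le> v (poly h x)"
    using pCons.prems[of "Suc _"] by (intro pCons.IH) simp
  then have "\<gamma> \<le> v (x * poly h x)" using x by (simp add: v_mult)
  ultimately show ?case using v_add[of a "x * poly h x"] by (simp add: min_def split: if_splits)
qed simp

lemma mem_value_group: "\<gamma> \<in> value_group v K \<longleftrightarrow> (\<exists>x\<in>K. x \<noteq> 0 \<and> val x = \<gamma>)"
  by (auto simp: value_group_def v_eq_Fin)

lemma add_subgroup_value_group:
  assumes "subfield K ring_of_type_algebra"
  shows "add_subgroup (value_group v K) (value_group v K)"
proof -
  note closed = subfield_1[OF assms] subfield_mult[OF assms] subfield_inverse[OF assms]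
  show ?thesis
    unfolding add_subgroup_def
  proof (intro conjI ballI)
    show "0 \<in> value_group v K" unfolding mem_value_group using closed by (intro bexI[of _ 1]) auto
    show "\<gamma> + \<delta> \<in> value_group v K" if \<gamma>\<delta>: "\<gamma> \<in> value_group v K" "\<delta> \<in> value_group v K" for \<gamma> \<delta>
    proof -
      obtain x where "x \<in> K" "x \<noteq> 0" "val x = \<gamma>" using \<gamma>\<delta>(1) unfolding mem_value_group by blast
      moreover obtain y where "y \<in> K" "y \<noteq> 0" "val y = \<delta>"
        using \<gamma>\<delta>(2) unfolding mem_value_group by blast
      ultimately show ?thesis
        unfolding mem_value_group using closed by (intro bexI[of _ "x * y"]) (auto simp: val_mult)
    qed
    show "- \<gamma> \<in> value_group v K" if \<gamma>: "\<gamma> \<in> value_group v K" for \<gamma>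
    proof -
      obtain x where "x \<in> K" "x \<noteq> 0" "val x = \<gamma>" using \<gamma> unfolding mem_value_group by blast
      then show ?thesis unfolding mem_value_group using closed by (intro bexI[of _ "inverse x"]) (auto simp: val_inverse)
    qed
  qed simp
qed

end

section \<open>Residue fields and immediate extensions\<close>

context krull_valuation
begin

text \<open>
  The valuation ring as a ring in its own right, and the residue map on it. Outside the valuation ring
  \<open>residue\<close> is meaningless.
\<close>

definition val_subring :: "'l ring"
  where "val_subring = ring_of_type_algebra\<lparr>carrier := val_ring v UNIV\<rparr>"

definition residue :: "'l \<Rightarrow> 'l set"
  where "residue x = val_ideal v UNIV +>\<^bsub>val_subring\<^esub> x"

lemma val_subring_simps [simp]:
  "carrier val_subring = {x. 0 \<le> v x}" "x \<otimes>\<^bsub>val_subring\<^esub> y = x * y" "x \<oplus>\<^bsub>val_subring\<^esub> y = x + y"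
  "\<one>\<^bsub>val_subring\<^esub> = 1" "\<zero>\<^bsub>val_subring\<^esub> = 0"
  by (simp_all add: val_subring_def ring_of_type_algebra_def val_ring_def)

lemma cring_val_subring: "cring val_subring"
proof -
  interpret A: cring "ring_of_type_algebra :: 'l ring" by (rule cring_from_type_algebra)
  have "subring (val_ring v UNIV) ring_of_type_algebra"
    using is_valuation_ring_val_ring[OF valuation] by (simp add: is_valuation_ring_def)
  then have "subcring (val_ring v UNIV) ring_of_type_algebra"
    by (rule A.subcringI') 
  then show ?thesis
    unfolding val_subring_def by (rule A.subcring_iff[THEN iffD1, rotated]) (simp add: ring_of_type_algebra_def)
qed

lemma val_subring_minus: "0 \<le> v x \<Longrightarrow> 0 \<le> v y \<Longrightarrow> x \<ominus>\<^bsub>val_subring\<^esub> y = x - y"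
proof -
  assume "0 \<le> v x" "0 \<le> v y"
  interpret cring val_subring by (rule cring_val_subring)
  have "\<ominus>\<^bsub>val_subring\<^esub> y = - y"
    using \<open>0 \<le> v y\<close> by (intro minus_equality) auto
  then show ?thesis by (simp add: a_minus_def)
qed

lemma v_pos_mult: "0 < v x \<Longrightarrow> 0 \<le> v y \<Longrightarrow> 0 < v (x * y)"
  by (cases "v x"; cases "v y") (auto simp: v_mult zero_extended_def add_pos_nonneg)

lemma val_ideal_ideal: "ideal (val_ideal v UNIV) val_subring"
proof -
  interpret cring val_subring by (rule cring_val_subring)
  have inv: "\<ominus>\<^bsub>val_subring\<^esub> y = - y" if "0 < v y" for y
    using that by (intro minus_equality) auto
  have "subgroup (val_ideal v UNIV) (add_monoid val_subring)"
  proof (rule add.subgroupI)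
    show "val_ideal v UNIV \<noteq> {}"
      using v_0 unfolding val_ideal_def zero_extended_def by (metis (mono_tags) UNIV_I empty_iff less_extended_simps(2) mem_Collect_eq)
    show "\<ominus>\<^bsub>val_subring\<^esub> y \<in> val_ideal v UNIV" if "y \<in> val_ideal v UNIV" for y
      using that inv[of y] by (simp add: val_ideal_def)
  qed (auto simp: val_ideal_def v_add_greater)
  then show ?thesis
    by (rule idealI[OF ring_axioms])
      (auto simp: val_ideal_def v_pos_mult mult.commute[of _ "_ :: 'l"] intro: v_pos_mult)
qed

lemma residue_field_eq: "residue_field v UNIV = val_subring Quot val_ideal v UNIV"
  by (simp add: residue_field_def val_subring_def)

lemma residue_hom: "ring_hom_cring val_subring (residue_field v UNIV) residue"
  and residue_hom_ring: "ring_hom_ring val_subring (residue_field v UNIV) residue"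
proof -
  have "residue = (+>\<^bsub>val_subring\<^esub>) (val_ideal v UNIV)" by (auto simp: residue_def)
  then show "ring_hom_cring val_subring (residue_field v UNIV) residue"
    "ring_hom_ring val_subring (residue_field v UNIV) residue"
    unfolding residue_field_eq
    using ideal.rcos_ring_hom_cring[OF val_ideal_ideal cring_val_subring]
      ideal.rcos_ring_hom_ring[OF val_ideal_ideal] by simp_all
qed

lemma residue_eq_iff:
  assumes "0 \<le> v x" "0 \<le> v y"
  shows "residue x = residue y \<longleftrightarrow> 0 < v (x - y)"
proof -
  interpret cring val_subring by (rule cring_val_subring)
  show ?thesis
    using quotient_eq_iff_same_a_r_cos[OF val_ideal_ideal, of x y] assms
    by (simp add: residue_def val_subring_minus val_ideal_def)
qed

lemma carrier_residue_field: "carrier (residue_field v UNIV) = residue ` {x. 0 \<le> v x}"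
  by (auto simp: residue_field_eq FactRing_def A_RCOSETS_def' residue_def)

lemma field_residue_field: "field (residue_field v UNIV)"
proof -
  interpret H: ring_hom_cring val_subring "residue_field v UNIV" residue by (rule residue_hom)
  have one: "\<one>\<^bsub>residue_field v UNIV\<^esub> = residue 1" and zero: "\<zero>\<^bsub>residue_field v UNIV\<^esub> = residue 0"
    using H.hom_one H.hom_zero by simp_all
  show ?thesis
  proof (rule H.S.cring_fieldI2)
    show "\<zero>\<^bsub>residue_field v UNIV\<^esub> \<noteq> \<one>\<^bsub>residue_field v UNIV\<^esub>"
      unfolding one zero by (subst residue_eq_iff) auto
    fix A assume A: "A \<in> carrier (residue_field v UNIV)" "A \<noteq> \<zero>\<^bsub>residue_field v UNIV\<^esub>"
    then obtain x where x: "0 \<le> v x" "A = residue x" by (auto simp: carrier_residue_field)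
    then have "\<not> 0 < v x" using A(2) residue_eq_iff[of x 0] by (simp add: zero)
    then have "v x = 0" using x(1) by simp
    then have x0: "x \<noteq> 0" by (auto simp: zero_extended_def)
    then have inv: "0 \<le> v (inverse x)" "x * inverse x = 1"
      using valuation_inverse_ge[OF valuation x0, of 1] \<open>v x = 0\<close> by auto
    then show "\<exists>B\<in>carrier (residue_field v UNIV). A \<otimes>\<^bsub>residue_field v UNIV\<^esub> B = \<one>\<^bsub>residue_field v UNIV\<^esub>"
      using x H.hom_mult[of x "inverse x"] unfolding one carrier_residue_field by auto
  qed
qed

lemma residue_subfield_eq: "residue_subfield v K = residue ` {x\<in>K. 0 \<le> v x}"
  by (auto simp: residue_subfield_def residue_def val_subring_def val_ring_def)

lemma subfield_residue_subfield:
  assumes K: "subfield K ring_of_type_algebra"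
  shows "subfield (residue_subfield v K) (residue_field v UNIV)"
proof -
  interpret H: ring_hom_cring val_subring "residue_field v UNIV" residue by (rule residue_hom)
  interpret F: field "residue_field v UNIV" by (rule field_residue_field)
  have one: "\<one>\<^bsub>residue_field v UNIV\<^esub> = residue 1" and zero: "\<zero>\<^bsub>residue_field v UNIV\<^esub> = residue 0"
    using H.hom_one H.hom_zero by simp_all
  note closed = subfield_0[OF K] subfield_1[OF K] subfield_add[OF K] subfield_mult[OF K]
    subfield_uminus[OF K] subfield_inverse[OF K]
  have nonneg: "0 \<le> v (x * y)" if "0 \<le> v x" "0 \<le> v y" for x y
    using add_mono[OF that] by (simp add: v_mult)
  have sub: "subring {x\<in>K. 0 \<le> v x} val_subring"
  proof (rule H.R.subringI)
    fix x assume x: "x \<in> {x\<in>K. 0 \<le> v x}"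
    then have "\<ominus>\<^bsub>val_subring\<^esub> x = - x" by (intro H.R.minus_equality) auto
    then show "\<ominus>\<^bsub>val_subring\<^esub> x \<in> {x\<in>K. 0 \<le> v x}" using x closed by simp
  qed (use closed nonneg in \<open>auto intro: order_trans[OF _ v_add]\<close>)
  show ?thesis
  proof (rule F.subfieldI')
    show "subring (residue_subfield v K) (residue_field v UNIV)"
      unfolding residue_subfield_eq
      by (rule ring_hom_ring.img_is_subring[OF residue_hom_ring sub])
    fix A assume A: "A \<in> residue_subfield v K - {\<zero>\<^bsub>residue_field v UNIV\<^esub>}"
    then obtain x where x: "x \<in> K" "0 \<le> v x" "A = residue x" by (auto simp: residue_subfield_eq)
    then have "\<not> 0 < v x" using A residue_eq_iff[of x 0] by (simp add: zero)
    then have "v x = 0" using x(2) by simp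
    then have x0: "x \<noteq> 0" by (auto simp: zero_extended_def)
    then have inv: "0 \<le> v (inverse x)" "x * inverse x = 1"
      using valuation_inverse_ge[OF valuation x0, of 1] \<open>v x = 0\<close> by auto
    have "inv\<^bsub>residue_field v UNIV\<^esub> A = residue (inverse x)"
      using x inv H.hom_mult[of x "inverse x"] 
      by (intro H.S.comm_inv_char) (auto simp: one carrier_residue_field)
    then show "inv\<^bsub>residue_field v UNIV\<^esub> A \<in> residue_subfield v K"
      using inv x closed by (auto simp: residue_subfield_eq)
  qed
qed

text \<open>
  A nontrivial linear relation over \<open>K\<close> can be divided by a coefficient of least value. Then all
  coefficients are integral and one of them is 1, so that its residue is a nontrivial relation over
  \<open>Kv\<close>.
\<close>

lemma independent_residues_lift:
  assumes K: "subfield K (ring_of_type_algebra :: 'l ring)"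
    and us: "\<And>u. u \<in> set us \<Longrightarrow> 0 \<le> v u"
    and indep: "ring.independent (residue_field v UNIV) (residue_subfield v K) (map residue us)"
  shows "ring.independent ring_of_type_algebra K us"
proof -
  let ?A = "ring_of_type_algebra :: 'l ring"
  interpret H: ring_hom_cring val_subring "residue_field v UNIV" residue by (rule residue_hom)
  interpret A: ring ?A by (rule ring_from_type_algebra)
  have A_simps: "carrier ?A = UNIV" "\<And>x y. x \<otimes>\<^bsub>?A\<^esub> y = x * y" "\<And>x y. x \<oplus>\<^bsub>?A\<^esub> y = x + y" "\<zero>\<^bsub>?A\<^esub> = 0"
    by (simp_all add: ring_of_type_algebra_def)
  have combine_eq: "A.combine ks us = H.R.combine ks us" for ks us
    by (induction ks us rule: A.combine.induct) (simp_all add: A_simps)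
  have combine_scale: "A.combine (map (\<lambda>k. k * s) ks) us = A.combine ks us * s" for ks us s
    by (induction ks us rule: A.combine.induct) (simp_all add: A_simps algebra_simps)
  note closed = subfield_mult[OF K] subfield_inverse[OF K]
  show ?thesis
  proof (rule A.trivial_combine_imp_independent[OF K])
    show "set us \<subseteq> carrier ?A" by (simp add: A_simps)
    fix ks assume ks: "set ks \<subseteq> K" "A.combine ks us = \<zero>\<^bsub>?A\<^esub>"
    show "set (take (length us) ks) \<subseteq> {\<zero>\<^bsub>?A\<^esub>}"
    proof (rule ccontr)
      assume nontriv: "\<not> set (take (length us) ks) \<subseteq> {\<zero>\<^bsub>?A\<^esub>}"
      define ls where "ls = take (length us) ks"
      define N where "N = {k \<in> set ls. k \<noteq> 0}"
      have N: "finite N" "N \<noteq> {}" using nontriv by (auto simp: N_def ls_def A_simps)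
      \<comment> \<open>A nonzero coefficient of least value.\<close>
      then obtain m where m: "m \<in> N" "\<And>k. k \<in> N \<Longrightarrow> val m \<le> val k"
        using ex_is_arg_min_if_finite[OF N, of val] by (auto simp: is_arg_min_def not_less)
      have m0: "m \<noteq> 0" "m \<in> K" "m \<in> set ls"
        using m(1) ks(1) set_take_subset[of "length us" ks] by (auto simp: N_def ls_def)
      define ns where "ns = map (\<lambda>k. k * inverse m) ls"
      have ns_K: "n \<in> K \<and> 0 \<le> v n" if n: "n \<in> set ns" for n
      proof -
        obtain k where k: "k \<in> set ls" "n = k * inverse m" using n by (auto simp: ns_def)
        then have "k \<in> K" using ks(1) set_take_subset[of "length us" ks] by (auto simp: ls_def)
        moreover have "0 \<le> v n"
        proof (cases "k = 0")
          case False
          then have "val m \<le> val k" using m(2) k by (simp add: N_def)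
          then show ?thesis
            using False m0 valuation_inverse_ge[OF valuation m0(1), of k] k by (simp add: v_eq_Fin)
        qed (simp add: k)
        ultimately show ?thesis using k m0 closed by simp
      qed
      have "A.combine ls us = 0"
        using ks A.combine_take[of us ks] 
        by (simp add: ls_def A_simps)
      then have zero: "H.R.combine ns us = 0"
        by (simp add: ns_def combine_scale flip: combine_eq)
      have "H.S.combine (map residue ns) (map residue us) = residue (H.R.combine ns us)"
        using ns_K us by (intro ring_hom_ring.combine_hom[OF residue_hom_ring]) auto
      also have "\<dots> = \<zero>\<^bsub>residue_field v UNIV\<^esub>" using zero H.hom_zero by simp
      finally have "set (take (length (map residue us)) (map residue ns)) \<subseteq> {\<zero>\<^bsub>residue_field v UNIV\<^esub>}"
        using ns_K
        by (intro H.S.independent_imp_trivial_combine[OF subfield_residue_subfield[OF K] indep])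
          (auto simp: residue_subfield_eq)
      moreover have "length ns \<le> length us" by (simp add: ns_def ls_def)
      moreover have "1 \<in> set ns" using m0 by (auto simp: ns_def image_iff intro!: bexI[of _ m])
      ultimately have "residue 1 = \<zero>\<^bsub>residue_field v UNIV\<^esub>" by auto
      then have "residue 1 = residue 0" using H.hom_zero by simp
      then show False by (subst (asm) residue_eq_iff) auto
    qed
  qed
qed

text \<open>
  The dimension in the definition of the inertia degree is a definite description, which says nothing
  unless \<open>Lv\<close> is known to be finite dimensional over \<open>Kv\<close>. This follows by lifting: an independent list
  of residues is not longer than the degree of the extension, so a longest one exists, and it spans.
\<close>

lemma residue_subfield_whole:
  assumes K: "subfield K (ring_of_type_algebra :: 'l ring)"
    and fin: "finite_extension K" and f: "inertia_degree v K = 1"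
  shows "residue_subfield v K = carrier (residue_field v UNIV)"
proof -
  let ?A = "ring_of_type_algebra :: 'l ring" and ?R = "residue_field v UNIV"
  let ?k = "residue_subfield v K"
  interpret A: ring ?A by (rule ring_from_type_algebra)
  interpret R: field ?R by (rule field_residue_field)
  note k = subfield_residue_subfield[OF K]
  obtain d where d: "A.dimension d K UNIV"
    using fin by (auto simp: finite_extension_def A.finite_dimension_def)
  have bound: "length Us \<le> d" if "R.independent ?k Us" for Us
  proof -
    have "set Us \<subseteq> carrier ?R" using that by (rule R.independent_in_carrier)
    then have "\<forall>U\<in>set Us. \<exists>u. 0 \<le> v u \<and> U = residue u" by (auto simp: carrier_residue_field)
    then obtain h where h: "\<And>U. U \<in> set Us \<Longrightarrow> 0 \<le> v (h U) \<and> U = residue (h U)" by metis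
    have "map residue (map h Us) = Us" using h by (simp add: map_idI)
    then have "A.independent K (map h Us)"
      using that h by (intro independent_residues_lift[OF K]) auto
    then show ?thesis
      using A.independent_length_le_dimension[OF K d] by fastforce
  qed
  define Q where "Q n \<longleftrightarrow> (\<exists>Us. R.independent ?k Us \<and> length Us = n)" for n
  have "Q 0" by (auto simp: Q_def)
  moreover have "\<And>n. Q n \<Longrightarrow> n \<le> d" using bound by (auto simp: Q_def)
  ultimately have "\<exists>n. Q n \<and> (\<forall>m. Q m \<longrightarrow> m \<le> n)"
    by (intro exI[of _ "Greatest Q"]) (auto intro: GreatestI_nat Greatest_le_nat)
  then obtain Us where Us: "R.independent ?k Us" "\<And>Vs. R.independent ?k Vs \<Longrightarrow> length Vs \<le> length Us"
    by (auto simp: Q_def)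
  have "R.Span ?k Us = carrier ?R"
  proof
    show "R.Span ?k Us \<subseteq> carrier ?R"
      using R.Span_in_carrier[OF subfieldE(3)[OF k] R.independent_in_carrier[OF Us(1)]] .
    show "carrier ?R \<subseteq> R.Span ?k Us"
    proof (rule ccontr)
      assume "\<not> carrier ?R \<subseteq> R.Span ?k Us"
      then obtain u where "u \<in> carrier ?R" "u \<notin> R.Span ?k Us" by auto
      then have "R.independent ?k (u # Us)" using Us(1) by (rule R.li_Cons)
      then show False using Us(2) by fastforce
    qed
  qed
  then have dim: "R.dimension (length Us) ?k (carrier ?R)"
    using R.dimensionI[OF k Us(1)] by simp
  then have "length Us = 1"
    using f R.dimI[OF k dim] by (simp add: inertia_degree_def over_def)
  then have dim1: "R.dimension 1 ?k (carrier ?R)" using dim by simp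
  have Span1: "R.Span ?k [\<one>\<^bsub>?R\<^esub>] \<subseteq> ?k"
    using subsetD[OF subfieldE(3)[OF k]] by (auto simp: R.line_extension_mem_iff)
  have "R.independent ?k [\<one>\<^bsub>?R\<^esub>]"
    by (intro R.li_Cons) auto
  then have "R.Span ?k [\<one>\<^bsub>?R\<^esub>] = carrier ?R"
    using R.independent_length_eq_dimension[OF k dim1, of "[\<one>\<^bsub>?R\<^esub>]"] by simp
  then show ?thesis using Span1 subfieldE(3)[OF k] by auto
qed

text \<open>
  There is only one coset of \<open>vK\<close>, so each coset \<open>g + vK\<close> contains 0.
\<close>

lemma value_group_whole:
  assumes "ramification_index v K = 1" "subfield K ring_of_type_algebra"
  shows "value_group v UNIV = value_group v K"
proof
  show "value_group v K \<subseteq> value_group v UNIV" by (auto simp: value_group_def)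
next
  let ?c = "\<lambda>g. (\<lambda>h. g + h) ` value_group v K"
  have zero: "0 \<in> value_group v K"
    using subfield_1[OF assms(2)] by (auto simp: value_group_def zero_extended_def intro!: bexI[of _ 1])
  have "card (cosets (value_group v UNIV) (value_group v K)) = 1"
    using assms(1) by (simp add: ramification_index_def)
  then obtain C where C: "cosets (value_group v UNIV) (value_group v K) = {C}"
    by (rule card_1_singletonE)
  show "value_group v UNIV \<subseteq> value_group v K"
  proof
    fix g assume g: "g \<in> value_group v UNIV"
    have coset: "?c x \<in> {C}" if "x \<in> value_group v UNIV" for x
      unfolding C[symmetric] cosets_def using that by (rule imageI)
    have "0 \<in> value_group v UNIV" using zero by (auto simp: value_group_def)
    from coset[OF g] coset[OF this] have "?c g = ?c 0" by (simp only: singleton_iff)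
    moreover have "g \<in> ?c g" using zero by force
    ultimately show "g \<in> value_group v K" by auto
  qed
qed

text \<open>
  Since \<open>vL = vK\<close>, some \<open>d\<close> in \<open>K\<close> has the value of \<open>x\<close>, and since \<open>Lv = Kv\<close>, some \<open>e\<close> in
  \<open>K\<close> has the residue of \<open>x / d\<close>; then \<open>d e\<close> approximates \<open>x\<close>.
\<close>

lemma exists_better_approximation:
  assumes K: "subfield K ring_of_type_algebra" and "finite_extension K"
    and "ramification_index v K = 1" "inertia_degree v K = 1" and x: "x \<noteq> 0"
  shows "\<exists>c\<in>K. v x < v (x - c)"
proof -
  have "val x \<in> value_group v UNIV"
    using x by (auto simp: value_group_def v_eq_Fin)
  then have "val x \<in> value_group v K"
    using value_group_whole assms(3) K by metis
  then obtain d where d: "d \<in> K" "d \<noteq> 0" "v d = v x"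
    using x by (auto simp: value_group_def v_eq_Fin)
  have "v (x / d) = 0" using d x by (simp add: v_eq_Fin val_divide zero_extended_def)
  then have "residue (x / d) \<in> residue_subfield v K"
    using residue_subfield_whole assms by (auto simp: carrier_residue_field)
  then obtain e where e: "e \<in> K" "0 \<le> v e" "residue (x / d) = residue e"
    by (auto simp: residue_subfield_eq)
  then have "0 < v (x / d - e)" using residue_eq_iff[of "x / d" e] \<open>v (x / d) = 0\<close> by simp
  moreover have "x - d * e = d * (x / d - e)" using d by (simp add: field_simps)
  ultimately have "v x < v (x - d * e)"
    using d by (cases "v (x / d - e)") (auto simp: v_mult v_eq_Fin x zero_extended_def)
  then show ?thesis using d(1) e(1) subfield_mult[OF K] by blast
qed

end

section \<open>Polynomials over a subfield\<close>

definition coeffs_in :: "'l::field set \<Rightarrow> 'l poly \<Rightarrow> bool"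
  where "coeffs_in K g \<longleftrightarrow> (\<forall>i. Polynomial.coeff g i \<in> K)"

text \<open>
  Division with remainder does not leave the polynomials over \<open>K\<close>, because the leading terms are divided
  within \<open>K\<close>.
\<close>

lemma coeffs_in_division:
  fixes K :: "'l::field set"
  assumes K: "subfield K ring_of_type_algebra"
    and f: "coeffs_in K f" "f \<noteq> 0" and g: "coeffs_in K g"
  shows "\<exists>q r. coeffs_in K q \<and> coeffs_in K r \<and> g = q * f + r \<and>
    (r = 0 \<or> Polynomial.degree r < Polynomial.degree f)"
  using g
proof (induction g rule: measure_induct_rule[of "\<lambda>g. if g = 0 then 0 else Suc (Polynomial.degree g)"])
  case (less g)
  note closed = subfield_0[OF K] subfield_add[OF K] subfield_mult[OF K] subfield_uminus[OF K]
    subfield_inverse[OF K]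
  show ?case
  proof (cases "g = 0 \<or> Polynomial.degree g < Polynomial.degree f")
    case True
    then show ?thesis
      using less.prems closed by (intro exI[of _ 0] exI[of _ g]) (auto simp: coeffs_in_def)
  next
    case False
    define n where "n = Polynomial.degree g - Polynomial.degree f"
    define \<mu> where "\<mu> = lead_coeff g / lead_coeff f"
    define m where "m = Polynomial.monom \<mu> n"
    have \<mu>: "\<mu> \<in> K" "\<mu> \<noteq> 0"
      using closed less.prems f False by (auto simp: \<mu>_def coeffs_in_def divide_inverse)
    have mf: "Polynomial.degree (m * f) = Polynomial.degree g" "m * f \<noteq> 0"
      using \<mu> f False by (auto simp: m_def degree_mult_eq degree_monom_eq n_def)
    have lead: "Polynomial.coeff (m * f) (Polynomial.degree g) = lead_coeff g"
      using False f by (simp add: m_def coeff_monom_mult n_def \<mu>_def)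
    define h where "h = g - m * f"
    have h_K: "coeffs_in K h"
      using less.prems f(1) \<mu>(1) closed unfolding h_def m_def coeffs_in_def
      by (auto simp: coeff_monom_mult diff_conv_add_uminus simp del: add_uminus_conv_diff)
    have "h = 0 \<or> Polynomial.degree h < Polynomial.degree g"
    proof (cases "Polynomial.degree g = 0")
      case True
      then have "Polynomial.degree h = 0"
        using degree_diff_le_max[of g "m * f"] mf by (simp add: h_def)
      then have "h = 0" using lead True by (metis coeff_diff eq_iff_diff_eq_0 h_def leading_coeff_0_iff)
      then show ?thesis ..
    next
      case False
      have "Polynomial.degree h \<le> Polynomial.degree g"
        using degree_diff_le_max[of g "m * f"] mf by (simp add: h_def)
      moreover have "Polynomial.coeff h (Polynomial.degree g) = 0" using lead by (simp add: h_def)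
      ultimately show ?thesis
        by (metis leading_coeff_0_iff nat_less_le)
    qed
    then have "(if h = 0 then 0 else Suc (Polynomial.degree h)) < (if g = 0 then 0 else Suc (Polynomial.degree g))"
      using False by auto
    then obtain q r where qr: "coeffs_in K q" "coeffs_in K r" "h = q * f + r"
        "r = 0 \<or> Polynomial.degree r < Polynomial.degree f"
      using less.IH[of h] h_K by blast
    have "coeffs_in K (q + m)"
      using qr(1) \<mu>(1) closed by (auto simp: coeffs_in_def m_def)
    moreover have "g = (q + m) * f + r" using qr(3) by (simp add: h_def algebra_simps)
    ultimately show ?thesis using qr by blast
  qed
qed

text \<open>
  If \<open>g\<close> has degree \<open>n + 1\<close>, this is the coefficient next to the leading one in the expansion of \<open>g\<close>
  at \<open>t\<close>.
\<close>

lemma coeff_pcompose_linear: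
  "Polynomial.degree g \<le> Suc n \<Longrightarrow>
    Polynomial.coeff (pcompose g [:t, 1:]) n =
      Polynomial.coeff g n + of_nat (Suc n) * t * Polynomial.coeff g (Suc n)"
  for g :: "'a::idom poly"
proof (induction g arbitrary: n)
  case 0
  then show ?case by simp
next
  case (pCons a g)
  show ?case
  proof (cases n)
    case 0
    have "Polynomial.degree g = 0" using pCons.prems 0 by (cases "g = 0") auto
    then obtain b where "g = [:b:]" by (rule degree_eq_zeroE)
    then show ?thesis using 0 by (simp add: pcompose_pCons)
  next
    case (Suc m)
    have dg: "Polynomial.degree g \<le> Suc m" using pCons.prems Suc by (cases "g = 0") auto
    have top: "Polynomial.coeff (pcompose g [:t, 1:]) (Suc m) = Polynomial.coeff g (Suc m)"
    proof (cases "Polynomial.degree g = Suc m")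
      case True
      then show ?thesis
        using lead_coeff_comp[of "[:t, 1:]" g] by (simp add: degree_pcompose)
    next
      case False
      then show ?thesis using dg by (simp add: coeff_eq_0 degree_pcompose)
    qed
    show ?thesis
      using pCons.IH[OF dg] top Suc
      by (simp add: pcompose_pCons mult_pCons_left algebra_simps)
  qed
qed

lemma coeffs_in_pCons [simp]: "coeffs_in K (pCons a g) \<longleftrightarrow> a \<in> K \<and> coeffs_in K g"
proof
  assume L: "coeffs_in K (pCons a g)"
  have "Polynomial.coeff (pCons a g) 0 \<in> K" "Polynomial.coeff (pCons a g) (Suc i) \<in> K" for i
    using L unfolding coeffs_in_def by blast+
  then show "a \<in> K \<and> coeffs_in K g" by (simp add: coeffs_in_def)
qed (auto simp: coeffs_in_def coeff_pCons split: nat.splits)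

text \<open>
  The element \<open>\<theta>\<close> is algebraic over \<open>K\<close> by finiteness, so the polynomial expressions in it already form
  a field.
\<close>

lemma generates_imp_poly:
  fixes K :: "'l::field set"
  assumes K: "subfield K ring_of_type_algebra" and fin: "finite_extension K" and gen: "generates K \<theta>"
  shows "\<exists>g. coeffs_in K g \<and> b = poly g \<theta>"
proof -
  let ?A = "ring_of_type_algebra :: 'l ring"
  interpret A: field ?A by (rule field_from_type_algebra)
  have simps: "carrier ?A = UNIV" "\<And>x y. x \<otimes>\<^bsub>?A\<^esub> y = x * y" "\<And>x y. x \<oplus>\<^bsub>?A\<^esub> y = x + y" "\<zero>\<^bsub>?A\<^esub> = 0"
    by (simp_all add: ring_of_type_algebra_def)
  have th: "\<theta> \<in> carrier ?A" by (simp add: simps)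
  have "subring (UNIV :: 'l set) ?A"
    using A.carrier_is_subring by (simp add: simps)
  then have "(A.algebraic over K) \<theta>"
    using A.finite_dimension_imp_algebraic[OF K] fin by (auto simp: finite_extension_def)
  then have "subfield (A.simple_extension K \<theta>) ?A"
    using A.simple_extension_is_subfield[OF K th] by simp
  moreover have "insert \<theta> K \<subseteq> A.simple_extension K \<theta>"
    using A.simple_extension_mem[OF subfieldE(1)[OF K] th] A.simple_extension_incl[OF subfieldE(3)[OF K] th]
    by simp
  ultimately have "generate_field ?A (insert \<theta> K) \<subseteq> A.simple_extension K \<theta>"
    by (intro A.generate_field_min_subfield1) (auto simp: simps)
  then have "b \<in> A.simple_extension K \<theta>" using gen by (auto simp: generates_def)
  then show ?thesis
  proof (induction rule: A.simple_extension.induct)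
    case zero
    show ?case using subfield_0[OF K] by (intro exI[of _ 0]) (simp add: coeffs_in_def simps)
  next
    case (lin k1 k2)
    then obtain g where "coeffs_in K g" "k1 = poly g \<theta>" by blast
    then show ?case using lin by (intro exI[of _ "pCons k2 g"]) (simp add: simps algebra_simps)
  qed
qed

section \<open>Values of polynomials close to an element without best approximation\<close>

text \<open>
  The values \<open>v (\<theta> - c)\<close> with \<open>c\<close> in \<open>K\<close> have no maximum. This is what immediacy of the extension
  provides for a generator \<open>\<theta>\<close>, and it is the only property of \<open>\<theta>\<close> used in this section.
\<close>

locale immediate_approximation = krull_valuation v
  for v :: "'l::field \<Rightarrow> 'g::linordered_ab_group_add extended" +
  fixes K :: "'l set" and \<theta> :: 'l
  assumes subfield: "subfield K ring_of_type_algebra"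
    and no_best: "\<And>c. c \<in> K \<Longrightarrow> \<exists>d\<in>K. v (\<theta> - c) < v (\<theta> - d)"
begin

lemmas K_closed = subfield_0[OF subfield] subfield_1[OF subfield] subfield_add[OF subfield]
  subfield_mult[OF subfield] subfield_uminus[OF subfield] subfield_inverse[OF subfield]

lemma theta_notin: "c \<in> K \<Longrightarrow> \<theta> - c \<noteq> 0"
  using no_best[of c] by auto

text \<open>
  Statements that hold for all \<open>c\<close> in \<open>K\<close> sufficiently close to \<open>\<theta>\<close> are those that hold eventually
  along this filter. It takes the role of a pseudo-Cauchy sequence with limit \<open>\<theta>\<close>.
\<close>

definition near :: "'l filter"
  where "near = (INF d\<in>K. principal {c\<in>K. v (\<theta> - d) \<le> v (\<theta> - c)})"

lemma eventually_near:
  "eventually Q near \<longleftrightarrow> (\<exists>d\<in>K. \<forall>c\<in>K. v (\<theta> - d) \<le> v (\<theta> - c) \<longrightarrow> Q c)"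
proof -
  have "\<exists>x\<in>K. principal {c\<in>K. v (\<theta> - x) \<le> v (\<theta> - c)}
      \<le> inf (principal {c\<in>K. v (\<theta> - a) \<le> v (\<theta> - c)}) (principal {c\<in>K. v (\<theta> - b) \<le> v (\<theta> - c)})"
    if "a \<in> K" "b \<in> K" for a b
  proof (cases "v (\<theta> - a) \<le> v (\<theta> - b)")
    case True
    then show ?thesis using that by (intro bexI[of _ b]) auto
  next
    case False
    then show ?thesis using that by (intro bexI[of _ a]) auto
  qed
  then show ?thesis
    unfolding near_def using K_closed(1)
    by (subst eventually_INF_base) (auto simp: eventually_principal)
qed

lemma near_neq_bot: "near \<noteq> bot"
  unfolding trivial_limit_def eventually_near by auto

lemma eventually_near_in: "\<forall>\<^sub>F c in near. c \<in> K"
  unfolding eventually_near using K_closed(1) by auto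

abbreviation approx_val :: "'l \<Rightarrow> 'g"
  where "approx_val c \<equiv> val (\<theta> - c)"

lemma v_theta_diff_less: "c \<in> K \<Longrightarrow> d \<in> K \<Longrightarrow> v (\<theta> - c) < v (\<theta> - d) \<longleftrightarrow> approx_val c < approx_val d"
  using theta_notin by (simp add: v_eq_Fin)

lemma eventually_near_greater: "d \<in> K \<Longrightarrow> \<forall>\<^sub>F c in near. approx_val d < approx_val c"
  unfolding eventually_near using no_best[of d]
  by (metis v_theta_diff_less less_le_trans)

text \<open>
  The value of \<open>t (\<theta> - c)\<^sup>k\<close>, where \<open>t\<close> has value \<open>\<beta>\<close>: a linear function of \<open>v (\<theta> - c)\<close> with
  slope \<open>k\<close>.
\<close>

definition line :: "'g \<Rightarrow> nat \<Rightarrow> 'l \<Rightarrow> 'g"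
  where "line \<beta> k c = \<beta> + nmult k (approx_val c)"

lemma line_less_iff: "line \<beta> k c < line \<gamma> (k + d) c \<longleftrightarrow> \<beta> - \<gamma> < nmult d (approx_val c)"
  by (simp add: line_def nmult_plus algebra_simps less_diff_eq)

text \<open>
  The difference of two lines of different slopes is strictly monotone in \<open>v (\<theta> - c)\<close>, so its sign is
  eventually constant. It is not eventually 0, since \<open>v (\<theta> - c)\<close> can always be increased.
\<close>

lemma lines_cross_once:
  assumes "k < l"
  shows "(\<forall>\<^sub>F c in near. line \<beta> k c < line \<gamma> l c) \<or> (\<forall>\<^sub>F c in near. line \<gamma> l c < line \<beta> k c)"
proof -
  obtain d where d: "l = k + d" "d > 0"
    using assms by (metis less_imp_add_positive)
  show ?thesis
  proof (cases "\<exists>c\<in>K. \<beta> - \<gamma> \<le> nmult d (approx_val c)")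
    case True
    then obtain c where c: "c \<in> K" "\<beta> - \<gamma> \<le> nmult d (approx_val c)" by auto
    have "\<forall>\<^sub>F e in near. line \<beta> k e < line \<gamma> l e"
      using eventually_near_greater[OF c(1)]
      by eventually_elim
        (use c(2) d nmult_strict_mono[of d] in \<open>auto simp: line_less_iff intro: le_less_trans\<close>)
    then show ?thesis ..
  next
    case False
    have "\<forall>\<^sub>F e in near. line \<gamma> l e < line \<beta> k e"
      using eventually_near_in
    proof eventually_elim
      case (elim e)
      then have "nmult d (approx_val e) < \<beta> - \<gamma>" using False by (auto simp: not_le)
      then show ?case by (simp add: d line_def nmult_plus algebra_simps less_diff_eq)
    qed
    then show ?thesis ..
  qed
qed

lemma exists_lowest_line:
  assumes "finite I" "I \<noteq> {}"
  shows "\<exists>k\<in>I. \<forall>\<^sub>F c in near. \<forall>l\<in>I - {k}. line (\<beta> k) k c < line (\<beta> l) l c"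
  using assms
proof (induction I rule: finite_ne_induct)
  case (singleton k)
  then show ?case by simp
next
  case (insert j I)
  then obtain k where k: "k \<in> I" "\<forall>\<^sub>F c in near. \<forall>l\<in>I - {k}. line (\<beta> k) k c < line (\<beta> l) l c"
    by auto
  then have "j \<noteq> k" using insert by auto
  then have "(\<forall>\<^sub>F c in near. line (\<beta> k) k c < line (\<beta> j) j c) \<or>
      (\<forall>\<^sub>F c in near. line (\<beta> j) j c < line (\<beta> k) k c)"
    using lines_cross_once[of j k "\<beta> j" "\<beta> k"] lines_cross_once[of k j "\<beta> k" "\<beta> j"]
    by (auto simp: neq_iff)
  then show ?case
  proof
    assume "\<forall>\<^sub>F c in near. line (\<beta> k) k c < line (\<beta> j) j c"
    with k(2) have "\<forall>\<^sub>F c in near. \<forall>l\<in>insert j I - {k}. line (\<beta> k) k c < line (\<beta> l) l c"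
      by eventually_elim auto
    then show ?thesis using k(1) by blast
  next
    assume "\<forall>\<^sub>F c in near. line (\<beta> j) j c < line (\<beta> k) k c"
    with k(2) have "\<forall>\<^sub>F c in near. \<forall>l\<in>insert j I - {j}. line (\<beta> j) j c < line (\<beta> l) l c"
      by eventually_elim (metis Diff_iff insert_iff less_trans)
    then show ?thesis by blast
  qed
qed

lemma lines_eventually_differ:
  assumes "k \<noteq> l" shows "\<forall>\<^sub>F c in near. line \<beta> k c \<noteq> line \<gamma> l c"
proof -
  have "(\<forall>\<^sub>F c in near. line \<beta> k c < line \<gamma> l c) \<or> (\<forall>\<^sub>F c in near. line \<gamma> l c < line \<beta> k c)"
    using lines_cross_once assms by (metis linorder_neqE_nat)
  then show ?thesis by (auto elim: eventually_mono)
qed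

lemma slope_unique:
  assumes "\<forall>\<^sub>F c in near. line \<beta> k c = line \<gamma> l c"
  shows "k = l"
proof (rule ccontr)
  assume "k \<noteq> l"
  from assms lines_eventually_differ[OF this, of \<beta> \<gamma>] have "\<forall>\<^sub>F c in near. False"
    by eventually_elim simp
  then show False using near_neq_bot by simp
qed

text \<open>
  Slope 0 means that \<open>v (g(c))\<close> is eventually constant, which is Kaplansky's condition that \<open>g\<close> does not
  increase along the approximations.
\<close>

definition slope :: "'l poly \<Rightarrow> nat \<Rightarrow> bool"
  where "slope g k \<longleftrightarrow> (\<exists>\<beta>. \<forall>\<^sub>F c in near. v (poly g c) = Fin (line \<beta> k c))"

lemma slope_functional:
  assumes "slope g k" "slope g l" shows "k = l"
proof -
  obtain \<beta> \<gamma> where "\<forall>\<^sub>F c in near. v (poly g c) = Fin (line \<beta> k c)"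
      "\<forall>\<^sub>F c in near. v (poly g c) = Fin (line \<gamma> l c)"
    using assms by (auto simp: slope_def)
  then have "\<forall>\<^sub>F c in near. line \<beta> k c = line \<gamma> l c" by eventually_elim simp
  then show ?thesis by (rule slope_unique)
qed

lemma slope_mult:
  assumes "slope g k" "slope h l" shows "slope (g * h) (k + l)"
proof -
  obtain \<beta> \<gamma> where "\<forall>\<^sub>F c in near. v (poly g c) = Fin (line \<beta> k c)"
      "\<forall>\<^sub>F c in near. v (poly h c) = Fin (line \<gamma> l c)"
    using assms by (auto simp: slope_def)
  then have "\<forall>\<^sub>F c in near. v (poly (g * h) c) = Fin (line (\<beta> + \<gamma>) (k + l) c)"
    by eventually_elim (simp add: v_mult line_def nmult_plus algebra_simps)
  then show ?thesis by (auto simp: slope_def)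
qed

text \<open>
  Its coefficients are the coefficients of \<open>g\<close> in powers of \<open>X - \<theta>\<close>, that is, the Hasse derivatives of
  \<open>g\<close> at \<open>\<theta>\<close>.
\<close>

definition taylor :: "'l poly \<Rightarrow> 'l poly"
  where "taylor g = pcompose g [:\<theta>, 1:]"

lemma poly_taylor: "poly (taylor g) x = poly g (\<theta> + x)"
  by (simp add: taylor_def poly_pcompose)

lemma degree_taylor [simp]: "Polynomial.degree (taylor g) = Polynomial.degree g"
  by (simp add: taylor_def degree_pcompose)

lemma taylor_eq_0_iff [simp]: "taylor g = 0 \<longleftrightarrow> g = 0"
  by (simp add: taylor_def pcompose_eq_0_iff)

lemma taylor_0 [simp]: "Polynomial.coeff (taylor g) 0 = poly g \<theta>"
  by (simp add: poly_taylor flip: poly_0_coeff_0)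

text \<open>
  In the expansion of \<open>g(c)\<close> in powers of \<open>c - \<theta>\<close> the values of the terms are lines with distinct
  slopes. Eventually one of them lies strictly below the others, and by the ultrametric inequality it is
  the value of the sum. The expansion point \<open>\<theta>\<close> does not depend on \<open>c\<close>, so neither do the
  coefficients.
\<close>

lemma slope_from_taylor:
  assumes "g \<noteq> 0"
  obtains k where "k \<le> Polynomial.degree g" "slope g k" "Polynomial.coeff (taylor g) k \<noteq> 0"
    "\<And>l. l \<noteq> k \<Longrightarrow> Polynomial.coeff (taylor g) l \<noteq> 0 \<Longrightarrow>
      \<forall>\<^sub>F c in near. line (val (Polynomial.coeff (taylor g) k)) k c
        < line (val (Polynomial.coeff (taylor g) l)) l c"
proof -
  define t where "t = Polynomial.coeff (taylor g)"
  define I where "I = {l. l \<le> Polynomial.degree g \<and> t l \<noteq> 0}"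
  have fin: "finite I" by (simp add: I_def)
  have in_I: "l \<in> I" if "t l \<noteq> 0" for l
    using that le_degree[of "taylor g" l] by (simp add: I_def t_def)
  have "Polynomial.degree g \<in> I"
    using assms leading_coeff_neq_0[of "taylor g"] in_I by (simp add: t_def)
  then obtain k where k: "k \<in> I"
    and least: "\<forall>\<^sub>F c in near. \<forall>l\<in>I - {k}. line (val (t k)) k c < line (val (t l)) l c"
    using exists_lowest_line[OF fin, of "\<lambda>l. val (t l)"] by blast
  have "\<forall>\<^sub>F c in near. v (poly g c) = Fin (line (val (t k)) k c)"
    using least eventually_near_in
  proof eventually_elim
    case (elim c)
    have nz: "c - \<theta> \<noteq> 0" using theta_notin[OF elim(2)] by auto
    have d: "val (c - \<theta>) = approx_val c"
      using v_diff_commute[of c \<theta>] nz theta_notin[OF elim(2)] by (simp add: v_eq_Fin)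
    have term_val: "v (t l * (c - \<theta>) ^ l) = Fin (line (val (t l)) l c)" if "l \<in> I" for l
      using that nz d by (simp add: I_def v_mult val_power v_eq_Fin line_def)
    have "poly g c = poly (taylor g) (c - \<theta>)" by (simp add: poly_taylor)
    also have "\<dots> = (\<Sum>l\<le>Polynomial.degree g. t l * (c - \<theta>) ^ l)"
      by (simp add: poly_altdef t_def)
    also have "\<dots> = (\<Sum>l\<in>I. t l * (c - \<theta>) ^ l)"
      by (rule sum.mono_neutral_right) (auto simp: I_def)
    also have "v \<dots> = Fin (line (val (t k)) k c)"
      by (rule v_sum_strict_min[OF fin k]) (use elim k term_val in auto)
    finally show ?case .
  qed
  then have "slope g k" by (auto simp: slope_def)
  moreover have "\<forall>\<^sub>F c in near. line (val (t k)) k c < line (val (t l)) l c" if "l \<noteq> k" "t l \<noteq> 0" for l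
    using least by eventually_elim (use that in_I in auto)
  ultimately show thesis
    using k by (intro that[of k]) (auto simp: I_def t_def)
qed

end

section \<open>Artin-Schreier generators without best approximation\<close>

text \<open>
  The situation of an Artin-Schreier defect extension generated by \<open>\<theta>\<close>, as far as the valuation of
  polynomials is concerned.
\<close>

locale artin_schreier_approximation = immediate_approximation v K \<theta>
  for v :: "'l::field \<Rightarrow> 'g::linordered_ab_group_add extended" and K \<theta> +
  fixes p :: nat and a :: 'l
  assumes prime_p: "prime p" and char_p: "CHAR('l) = p"
    and root: "\<theta> ^ p - \<theta> = a" and a_in: "a \<in> K"
    and negative: "\<And>c. c \<in> K \<Longrightarrow> v (\<theta> - c) < 0"
begin

lemma p_gt_1: "p > 1"
  using prime_p by (rule prime_gt_1_nat)

lemma wp_diff: "wp (x - y) = wp x - wp (y :: 'l)"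
proof -
  have "(x - y) ^ p + y ^ p = x ^ p"
    using freshmans_dream[where ?'a = 'l, of p "x - y" y] prime_p char_p by (metis diff_add_cancel)
  then have "(x - y) ^ p = x ^ p - y ^ p" by (simp add: eq_diff_eq)
  then show ?thesis by (simp add: wp_def char_p algebra_simps)
qed

text \<open>
  For \<open>v x < 0\<close>, the term \<open>x\<^sup>p\<close> has smaller value than \<open>x\<close>.
\<close>

lemma v_wp_of_negative: "v x < 0 \<Longrightarrow> v (wp x) = nmult p (v x)"
proof -
  assume neg: "v x < 0"
  then have x: "x \<noteq> 0" by auto
  then have "val x < 0" using neg by (simp add: v_eq_Fin zero_extended_def)
  have "nmult p (val x) < val x"
  proof -
    have "p = Suc (p - 1)" "p - 1 > 0" using p_gt_1 by auto
    then show ?thesis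
      using nmult_strict_mono[of "p - 1" "val x" 0] \<open>val x < 0\<close>
      by (metis add_less_same_cancel2 nmult_Suc nmult_zero)
  qed
  then have "v (x ^ p) < v x" using x by (simp add: v_power) (simp add: v_eq_Fin)
  then show ?thesis
    using x v_diff_eq[of "x ^ p" x] by (simp add: wp_def char_p v_power) (simp add: v_eq_Fin nmult_Fin)
qed

lemma v_a_minus_wp:
  assumes "c \<in> K" shows "v (a - wp c) = nmult p (v (\<theta> - c))"
proof -
  have "a - wp c = wp (\<theta> - c)" using root by (simp add: wp_diff) (simp add: wp_def char_p)
  then show ?thesis using negative[OF assms] by (simp add: v_wp_of_negative)
qed

definition as_poly :: "'l poly"
  where "as_poly = Polynomial.monom 1 p - Polynomial.monom 1 1 - [:a:]"

lemma poly_as_poly: "poly as_poly x = wp x - a"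
  by (simp add: as_poly_def poly_monom wp_def char_p)

lemma coeffs_in_as_poly: "coeffs_in K as_poly"
  using K_closed a_in
  by (auto simp: coeffs_in_def as_poly_def coeff_pCons split: nat.splits)
    (metis K_closed add.right_neutral diff_conv_add_uminus)+

lemma degree_as_poly: "Polynomial.degree as_poly = p"
proof (rule antisym)
  show "Polynomial.degree as_poly \<le> p"
    using p_gt_1 unfolding as_poly_def
    by (intro degree_diff_le) (auto simp: degree_monom_le intro: order_trans[OF degree_monom_le])
  have "Polynomial.coeff as_poly p = 1"
    using p_gt_1 by (simp add: as_poly_def coeff_pCons split: nat.splits)
  then show "p \<le> Polynomial.degree as_poly" by (intro le_degree) simp
qed

lemma slope_as_poly: "slope as_poly p"
proof -
  have "\<forall>\<^sub>F c in near. v (poly as_poly c) = Fin (line 0 p c)"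
    using eventually_near_in
  proof eventually_elim
    case (elim c)
    have "v (poly as_poly c) = v (a - wp c)"
      by (simp add: poly_as_poly v_diff_commute)
    then show ?case
      using theta_notin[OF elim] v_a_minus_wp[OF elim] by (simp add: v_eq_Fin nmult_Fin line_def)
  qed
  then show ?thesis by (auto simp: slope_def)
qed

text \<open>
  If the slope were the degree \<open>n\<close>, then the leading term of the expansion at \<open>\<theta>\<close> would eventually have
  smaller value than the one next to it. The latter has coefficient \<open>n u (\<theta> - c)\<close>, where \<open>u\<close> is the
  leading coefficient and \<open>c\<close> in \<open>K\<close> is the mean of the roots of \<open>f\<close>; this requires that \<open>p\<close> does not
  divide \<open>n\<close>. So \<open>c\<close> would be a best approximation to \<open>\<theta>\<close>.
\<close>

lemma slope_less_degree:
  assumes f: "coeffs_in K f" and deg: "0 < Polynomial.degree f" "Polynomial.degree f < p"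
    and slope: "slope f k"
  shows "k < Polynomial.degree f"
proof -
  have "f \<noteq> 0" using deg by auto
  then obtain j where j: "j \<le> Polynomial.degree f" "slope f j"
    and low: "\<And>l. l \<noteq> j \<Longrightarrow> Polynomial.coeff (taylor f) l \<noteq> 0 \<Longrightarrow>
      \<forall>\<^sub>F c in near. line (val (Polynomial.coeff (taylor f) j)) j c
        < line (val (Polynomial.coeff (taylor f) l)) l c"
    using slope_from_taylor by blast
  have jk: "k = j" using slope j(2) by (rule slope_functional)
  obtain m where m: "Polynomial.degree f = Suc m" using deg by (cases "Polynomial.degree f") auto
  have "j \<noteq> Suc m"
  proof
    assume jm: "j = Suc m"
    define n :: 'l where "n = of_nat (Suc m)"
    define u where "u = Polynomial.coeff f (Suc m)"
    define c where "c = - (Polynomial.coeff f m / (n * u))"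
    have "\<not> p dvd Suc m" using deg m by (auto dest: dvd_imp_le)
    then have n: "n \<noteq> 0" unfolding n_def by (metis char_p of_nat_eq_0_iff_char_dvd)
    then have val_n: "val n = 0" unfolding n_def using char_p p_gt_1 by (intro val_of_nat) auto
    have u: "u \<noteq> 0" using m \<open>f \<noteq> 0\<close> by (metis leading_coeff_0_iff u_def)
    have nK: "of_nat i \<in> K" for i
      by (induction i) (use K_closed in auto)
    have c: "c \<in> K"
    proof -
      have "Polynomial.coeff f m \<in> K" "n * u \<in> K"
        using f nK[of "Suc m"] K_closed(4) unfolding coeffs_in_def u_def n_def by blast+
      then show ?thesis
        unfolding c_def divide_inverse by (rule K_closed(5)[OF K_closed(4)[OF _ K_closed(6)]])
    qed
    have top: "Polynomial.coeff (taylor f) (Suc m) = u"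
      using m lead_coeff_comp[of "[:\<theta>, 1:]" f] by (simp add: taylor_def degree_pcompose u_def)
    have sub: "Polynomial.coeff (taylor f) m = n * u * (\<theta> - c)"
    proof -
      have "Polynomial.coeff (taylor f) m = Polynomial.coeff f m + n * \<theta> * u"
        using m coeff_pcompose_linear[of f m \<theta>] by (simp only: taylor_def n_def u_def order_refl)
      moreover have "n * u * c = - Polynomial.coeff f m" using n u by (simp add: c_def)
      ultimately show ?thesis by (simp add: right_diff_distrib ac_simps)
    qed
    have ne: "\<theta> - c \<noteq> 0" using theta_notin[OF c] .
    have "val (Polynomial.coeff (taylor f) m) = val u + approx_val c"
      using sub n u ne val_n by (simp add: val_mult)
    \<comment> \<open>Cancelling \<open>m\<close> times the value of \<open>\<theta> - d\<close> leaves that \<open>d\<close> is no better than \<open>c\<close>.\<close>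
    then have "\<forall>\<^sub>F d in near. line (val u) (Suc m) d < line (val u + approx_val c) m d"
      using low[of m] jm top sub n u ne by simp
    then have "\<forall>\<^sub>F d in near. False"
      using eventually_near_greater[OF c]
      by eventually_elim (simp add: line_def algebra_simps)
    then show False using near_neq_bot by simp
  qed
  then show ?thesis using j m jk by simp
qed

text \<open>
  Lines of pairwise different slopes eventually have pairwise different values, but the least of
  \<open>v f\<close>, \<open>v g\<close> and \<open>v h\<close> is attained twice if \<open>f = g + h\<close>.
\<close>

lemma no_three_slopes:
  assumes sum: "f = g + h" and slopes: "slope f i" "slope g j" "slope h k"
    and distinct: "i \<noteq> j" "i \<noteq> k" "j \<noteq> k"
  shows False
proof -
  obtain \<beta> \<gamma> \<delta> where
      f: "\<forall>\<^sub>F c in near. v (poly f c) = Fin (line \<beta> i c)" and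
      g: "\<forall>\<^sub>F c in near. v (poly g c) = Fin (line \<gamma> j c)" and
      h: "\<forall>\<^sub>F c in near. v (poly h c) = Fin (line \<delta> k c)"
    using slopes by (auto simp: slope_def)
  have ij: "\<forall>\<^sub>F c in near. line \<beta> i c \<noteq> line \<gamma> j c"
    and ik: "\<forall>\<^sub>F c in near. line \<beta> i c \<noteq> line \<delta> k c"
    and jk: "\<forall>\<^sub>F c in near. line \<gamma> j c \<noteq> line \<delta> k c"
    using distinct by (simp_all add: lines_eventually_differ)
  have "\<forall>\<^sub>F c in near. False"
    using f g h ij ik jk
  proof eventually_elim
    case (elim c)
    have fgh: "poly f c = poly g c + poly h c" by (simp add: sum)
    show False
    proof (cases "line \<gamma> j c < line \<delta> k c")
      case True
      then have "v (poly f c) = v (poly g c)" using elim fgh v_add_eq[of "poly g c" "poly h c"] by simp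
      then show False using elim by simp
    next
      case False
      then have "line \<delta> k c < line \<gamma> j c" using elim by simp
      then have "v (poly f c) = v (poly h c)"
        using elim fgh v_add_eq[of "poly h c" "poly g c"] by (simp add: add.commute)
      then show False using elim by simp
    qed
  qed
  then show False using near_neq_bot by simp
qed

text \<open>
  This is where the degree \<open>p\<close> of the minimal polynomial \<open>X\<^sup>p - X - a\<close> enters. Its slope \<open>p\<close> cannot be
  reached by the product \<open>q f\<close> in the division with remainder \<open>X\<^sup>p - X - a = q f + r\<close>, because the slope
  of \<open>f\<close> is smaller than its degree. So \<open>r\<close> is not zero and has slope 0 by induction, and as three
  distinct slopes are impossible, \<open>q f\<close> must have slope 0.
\<close>

lemma slope_eq_0:
  assumes "coeffs_in K f" "f \<noteq> 0" "Polynomial.degree f < p"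
  shows "slope f 0"
  using assms
proof (induction "Polynomial.degree f" arbitrary: f rule: less_induct)
  case less
  obtain j where j: "j \<le> Polynomial.degree f" "slope f j"
    using slope_from_taylor[OF less.prems(2)] by blast
  show ?case
  proof (cases "Polynomial.degree f = 0")
    case True
    then show ?thesis using j by simp
  next
    case False
    then have j_less: "j < Polynomial.degree f"
      using slope_less_degree[OF less.prems(1) _ less.prems(3) j(2)] by simp
    obtain q r where qr: "coeffs_in K q" "coeffs_in K r" "as_poly = q * f + r"
        "r = 0 \<or> Polynomial.degree r < Polynomial.degree f"
      using coeffs_in_division[OF subfield less.prems(1,2) coeffs_in_as_poly] by blast
    have q: "q \<noteq> 0"
    proof
      assume "q = 0"
      then have "as_poly = r" using qr by simp
      then have "Polynomial.degree r = p" using degree_as_poly by simp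
      then show False using qr(4) less.prems(3) p_gt_1 by auto
    qed
    have deg: "Polynomial.degree q + Polynomial.degree f = p"
    proof -
      have "Polynomial.degree (q * f) = Polynomial.degree q + Polynomial.degree f"
        using q less.prems(2) by (rule degree_mult_eq)
      moreover have "Polynomial.degree (q * f + r) = Polynomial.degree (q * f)"
        using qr(4) False calculation by (intro degree_add_eq_left) auto
      ultimately show ?thesis using qr(3) degree_as_poly by simp
    qed
    obtain i where i: "i \<le> Polynomial.degree q" "slope q i"
      using slope_from_taylor[OF q] by blast
    have ij: "slope (q * f) (i + j)" using i(2) j(2) by (rule slope_mult)
    have ij_less: "i + j < p" using i j_less deg by linarith
    show ?thesis
    proof (cases "r = 0")
      case True
      then have "slope (q * f) p" using qr(3) slope_as_poly by simp
      then show ?thesis using slope_functional[OF ij] ij_less by blast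
    next
      case r: False
      then have "slope r 0" using less.hyps[of r] qr(2,4) less.prems(3) by simp
      then have "i + j = 0"
        using no_three_slopes[OF qr(3) slope_as_poly ij] ij_less p_gt_1 by fastforce
      then show ?thesis using j(2) by simp
    qed
  qed
qed

text \<open>
  Slope 0 means that eventually the constant term \<open>g(\<theta>)\<close> of the expansion has the least value, less than
  that of the \<open>l\<close>-th Taylor term. Dropping \<open>l - 1\<close> of the \<open>l\<close> summands \<open>v (\<theta> - c)\<close>, which are
  negative, makes the bound uniform in \<open>l\<close>.
\<close>

lemma taylor_terms_small:
  assumes g: "coeffs_in K g" "Polynomial.degree g < p" and nz: "g \<noteq> 0"
  shows "\<exists>c\<in>K. \<forall>l>0. Fin (val (poly g \<theta>) - approx_val c) \<le> v (Polynomial.coeff (taylor g) l)"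
proof -
  obtain k where k: "slope g k" "Polynomial.coeff (taylor g) k \<noteq> 0"
    and low: "\<And>l. l \<noteq> k \<Longrightarrow> Polynomial.coeff (taylor g) l \<noteq> 0 \<Longrightarrow>
      \<forall>\<^sub>F c in near. line (val (Polynomial.coeff (taylor g) k)) k c
        < line (val (Polynomial.coeff (taylor g) l)) l c"
    using slope_from_taylor[OF nz] by blast
  have k0: "k = 0" using slope_functional[OF k(1) slope_eq_0] g nz by blast
  define t where "t = Polynomial.coeff (taylor g)"
  have "\<forall>\<^sub>F c in near. \<forall>l\<in>{l. l \<le> Polynomial.degree g \<and> l > 0 \<and> t l \<noteq> 0}.
      line (val (t k)) k c < line (val (t l)) l c"
    using low k0 by (intro eventually_ball_finite) (auto simp: t_def)
  then have "\<forall>\<^sub>F c in near. c \<in> K \<and> (\<forall>l>0. Fin (val (poly g \<theta>) - approx_val c) \<le> v (t l))"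
    using eventually_near_in
  proof eventually_elim
    case (elim c)
    have "Fin (val (poly g \<theta>) - approx_val c) \<le> v (t l)" if l: "l > 0" for l
    proof (cases "t l = 0")
      case False
      have neg: "approx_val c < 0"
        using negative[OF elim(2)] theta_notin[OF elim(2)] by (simp add: v_eq_Fin zero_extended_def)
      have "l \<le> Polynomial.degree g" using False le_degree[of "taylor g" l] by (simp add: t_def)
      then have "line (val (t k)) k c < line (val (t l)) l c" using elim(1) l False by simp
      then have "val (poly g \<theta>) < val (t l) + nmult l (approx_val c)"
        using k0 by (simp add: line_def t_def)
      also have "nmult l (approx_val c) \<le> approx_val c"
        using nmult_ge_self[OF l, of "- approx_val c"] neg by (simp add: nmult_minus)
      finally show ?thesis using False by (simp add: v_eq_Fin diff_le_eq less_imp_le)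
    qed simp
    then show ?case using elim(2) by blast
  qed
  then have "\<exists>c. c \<in> K \<and> (\<forall>l>0. Fin (val (poly g \<theta>) - approx_val c) \<le> v (t l))"
    by (rule eventually_happens'[OF near_neq_bot])
  then show "\<exists>c\<in>K. \<forall>l>0. Fin (val (poly g \<theta>) - approx_val c) \<le> v (Polynomial.coeff (taylor g) l)"
    by (simp only: t_def Bex_def)
qed

end

section \<open>Automorphisms\<close>

lemma GalD:
  assumes "\<sigma> \<in> Gal K"
  shows "\<sigma> (x + y) = \<sigma> x + \<sigma> y" "\<sigma> (x * y) = \<sigma> x * \<sigma> y" "c \<in> K \<Longrightarrow> \<sigma> c = c" "inj \<sigma>"
  using assms by (auto simp: Gal_def bij_def)

lemma Gal_poly:
  assumes "\<sigma> \<in> Gal K" "coeffs_in K g" "0 \<in> K"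
  shows "\<sigma> (poly g x) = poly g (\<sigma> x)"
  using assms(2)
  by (induction g) (use GalD(1-3)[OF assms(1)] assms(3) in simp_all)

text \<open>
  The valuation \<open>v \<circ> \<sigma>\<close> also extends the valuation of \<open>K\<close>, so by uniqueness it is equivalent to \<open>v\<close>.
  Both agree on \<open>K\<close>, which attains all values.
\<close>

lemma (in krull_valuation) Gal_preserves_valuation:
  assumes K: "subfield K ring_of_type_algebra" and \<sigma>: "\<sigma> \<in> Gal K"
    and uni: "unibranched v K" and e: "value_group v UNIV = value_group v K"
  shows "v (\<sigma> x) = v x"
proof -
  note [simp] = GalD(1,2)[OF \<sigma>]
  have zero: "\<sigma> y = 0 \<longleftrightarrow> y = 0" for y
    using GalD(3)[OF \<sigma> subfield_0[OF K]] GalD(4)[OF \<sigma>] by (metis injD)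
  define w where "w y = v (\<sigma> y)" for y
  have w: "valuation w"
    using valuation zero by (simp add: valuation_def w_def)
  have "val_ring w UNIV \<inter> K = val_ring v K"
    using GalD(3)[OF \<sigma>] by (auto simp: val_ring_def w_def)
  then have "val_ring w UNIV = val_ring v UNIV"
    using uni is_valuation_ring_val_ring[OF w] by (auto simp: unibranched_def)
  then have order: "w y \<le> w x \<longleftrightarrow> v y \<le> v x" for x y
    using val_ring_eq_iff_equivalent[OF w valuation] by blast
  show ?thesis
  proof (cases "x = 0")
    case False
    then have "val x \<in> value_group v K"
      unfolding e[symmetric] by (auto simp: mem_value_group)
    then obtain c where c: "c \<in> K" "v c = v x"
      using False by (auto simp: mem_value_group v_eq_Fin)
    then have "w x = w c" using order[of x c] order[of c x] by simp
    then show ?thesis using c GalD(3)[OF \<sigma> c(1)] by (simp add: w_def)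
  qed (use zero[of 0] in simp)
qed

section \<open>The approximation distances of an Artin-Schreier generator\<close>

context artin_schreier_approximation
begin

text \<open>
  The negatives of the values \<open>v (\<theta> - c)\<close>; the negation makes them positive and turns the initial segment
  \<open>v (\<theta> - K)\<close> into a final one.
\<close>

definition distances :: "'g set"
  where "distances = (\<lambda>c. - approx_val c) ` K"

lemma v_theta_diff: "c \<in> K \<Longrightarrow> v (\<theta> - c) = Fin (approx_val c)"
  using theta_notin by (simp add: v_eq_Fin)

lemma approx_val_negative: "c \<in> K \<Longrightarrow> approx_val c < 0"
  using negative[of c] v_theta_diff[of c] by (simp add: zero_extended_def)

lemma value_set_theta: "value_set v \<theta> K = Fin ` uminus ` distances"
proof -
  have "value_set v \<theta> K = (\<lambda>c. v (\<theta> - c)) ` K" by (auto simp: value_set_def)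
  also have "\<dots> = Fin ` uminus ` distances"
    unfolding distances_def image_image by (rule image_cong) (simp_all add: v_theta_diff)
  finally show ?thesis .
qed

text \<open>
  If \<open>d\<close> in \<open>K\<close> has smaller value than \<open>\<theta> - c\<close>, then \<open>\<theta> - (c + d)\<close> has the value of \<open>d\<close>.
\<close>

lemma distances_upward:
  assumes "s \<in> distances" "g \<in> value_group v K" "s \<le> g"
  shows "g \<in> distances"
proof (cases "s = g")
  case False
  obtain c where c: "c \<in> K" "s = - approx_val c"
    using assms(1) unfolding distances_def by blast
  obtain x where x: "x \<in> K" "x \<noteq> 0" "val x = g" using assms(2) by (auto simp: mem_value_group)
  define d where "d = inverse x"
  have d: "d \<in> K" "v d = Fin (- g)"
    using x K_closed(6) by (simp_all add: d_def v_eq_Fin val_inverse)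
  have "s < g" using assms(3) False by simp
  then have "v d < v (\<theta> - c)" using d(2) c by (simp add: v_theta_diff minus_less_iff)
  then have "v (\<theta> - (c + d)) = v d"
    using v_diff_eq[of d "\<theta> - c"] v_diff_commute[of d "\<theta> - c"] by (simp add: algebra_simps)
  then have "approx_val (c + d) = - g"
    using d v_theta_diff[of "c + d"] K_closed(3)[OF c(1) d(1)] by simp
  then show ?thesis
    using K_closed(3)[OF c(1) d(1)] unfolding distances_def by (intro image_eqI[of _ _ "c + d"]) auto
qed (use assms in simp)

lemma value_set_a: "value_set v a (wp ` K) = nmult p ` value_set v \<theta> K"
  by (force simp: value_set_def v_a_minus_wp)

lemma exists_poly:
  assumes "\<exists>g. coeffs_in K g \<and> b = poly g \<theta>"
  obtains g where "coeffs_in K g" "Polynomial.degree g < p" "b = poly g \<theta>"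
proof -
  obtain f where f: "coeffs_in K f" "b = poly f \<theta>" using assms by blast
  have "as_poly \<noteq> 0" using degree_as_poly p_gt_1 by auto
  then obtain q r where qr: "coeffs_in K r" "f = q * as_poly + r" "r = 0 \<or> Polynomial.degree r < p"
    using coeffs_in_division[OF subfield coeffs_in_as_poly _ f(1)] degree_as_poly by auto
  have "poly as_poly \<theta> = 0" using root by (simp add: poly_as_poly wp_def char_p)
  then have "b = poly r \<theta>" using f(2) qr(2) by simp
  moreover have "Polynomial.degree r < p" using qr(3) p_gt_1 by auto
  ultimately show thesis using qr(1) that by blast
qed

text \<open>
  For \<open>b = \<theta> - c\<close> the quotient is \<open>i / (\<theta> - c)\<close>. Conversely, for \<open>b = g(\<theta>)\<close> the Taylor expansion of
  \<open>g\<close> at \<open>\<theta>\<close> gives \<open>\<sigma> b - b = i h(i)\<close>, where the coefficients of \<open>h\<close> are the higher Taylor coefficients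
  of \<open>g\<close>. Their values exceed \<open>v b\<close> by at least some element of \<open>distances\<close>, which is a final segment.
\<close>

lemma sigma_set_eq_distances:
  assumes repr: "\<And>b. \<exists>g. coeffs_in K g \<and> b = poly g \<theta>"
    and groups: "value_group v UNIV = value_group v K"
    and \<sigma>: "\<sigma> \<in> Gal K" "\<sigma> \<theta> = \<theta> + i" "v i = 0"
  shows "sigma_set v \<sigma> = Fin ` distances"
proof (rule subset_antisym; rule subsetI)
  fix \<gamma> assume "\<gamma> \<in> Fin ` distances"
  then obtain c where c: "c \<in> K" "\<gamma> = Fin (- approx_val c)" by (auto simp: distances_def)
  have i: "i \<noteq> 0" using \<sigma>(3) by (auto simp: zero_extended_def)
  then have "val i = 0" using \<sigma>(3) by (simp add: v_eq_Fin zero_extended_def)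
  have "\<sigma> (\<theta> - c) + c = \<theta> + i"
    using GalD(1)[OF \<sigma>(1), of "\<theta> - c" c] GalD(3)[OF \<sigma>(1) c(1)] \<sigma>(2) by simp
  then have "\<sigma> (\<theta> - c) - (\<theta> - c) = i" by (simp add: algebra_simps)
  moreover have "v (i / (\<theta> - c)) = \<gamma>"
    using c i \<open>val i = 0\<close> theta_notin[OF c(1)] by (simp add: v_eq_Fin val_divide)
  ultimately show "\<gamma> \<in> sigma_set v \<sigma>"
    using i theta_notin[OF c(1)] unfolding sigma_set_def
    by (intro CollectI exI[of _ "\<theta> - c"]) auto
next
  fix \<gamma> assume "\<gamma> \<in> sigma_set v \<sigma>"
  then obtain b where b: "b \<noteq> 0" "\<sigma> b - b \<noteq> 0" "\<gamma> = v ((\<sigma> b - b) / b)"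
    by (auto simp: sigma_set_def)
  obtain g where g: "coeffs_in K g" "Polynomial.degree g < p" "b = poly g \<theta>"
    using exists_poly[OF repr] .
  then have "g \<noteq> 0" using b(1) by auto
  then obtain c where c: "c \<in> K"
      "\<And>l. l > 0 \<Longrightarrow> Fin (val b - approx_val c) \<le> v (Polynomial.coeff (taylor g) l)"
    using taylor_terms_small[OF g(1,2)] g(3) by blast
  obtain h where h: "taylor g = pCons b h"
    using g(3) by (metis coeff_pCons_0 pCons_cases taylor_0)
  have "\<sigma> b = poly (taylor g) i"
    using Gal_poly[OF \<sigma>(1) g(1) K_closed(1), of \<theta>] g(3) \<sigma>(2) by (simp add: poly_taylor)
  then have diff: "\<sigma> b - b = i * poly h i" by (simp add: h)
  have "Fin (val b - approx_val c) \<le> v (poly h i)"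
    using c(2)[of "Suc _"] \<sigma>(3) by (intro v_poly_ge) (simp_all add: h)
  then have "Fin (val b - approx_val c) \<le> v (\<sigma> b - b)" by (simp add: diff v_mult \<sigma>(3))
  then have ge: "- approx_val c \<le> val ((\<sigma> b - b) / b)"
    using b by (simp add: v_eq_Fin val_divide algebra_simps)
  have "val ((\<sigma> b - b) / b) \<in> value_group v K"
    unfolding groups[symmetric] mem_value_group using b by (intro bexI[of _ "(\<sigma> b - b) / b"]) auto
  moreover have "- approx_val c \<in> distances" using c(1) by (simp add: distances_def)
  ultimately have "val ((\<sigma> b - b) / b) \<in> distances"
    using distances_upward[OF _ _ ge] by blast
  then show "\<gamma> \<in> Fin ` distances" using b by (simp add: v_eq_Fin)
qed

lemma positive_final_segment_distances:
  assumes "value_group v UNIV = value_group v K"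
  shows "positive_final_segment (value_group v K) distances p"
proof
  show "add_subgroup (value_group v K) (value_group v K)"
    by (rule add_subgroup_value_group[OF subfield])
  show "distances \<noteq> {}" using K_closed(1) by (auto simp: distances_def)
  show "1 < p" by (rule p_gt_1)
  show "0 < s" if "s \<in> distances" for s
    using that approx_val_negative by (auto simp: distances_def)
  show "g \<in> distances" if "s \<in> distances" "g \<in> value_group v K" "s \<le> g" for s g
    using that by (rule distances_upward)
  have "- approx_val c \<in> value_group v K" if "c \<in> K" for c
  proof -
    have "approx_val c \<in> value_group v K"
      unfolding assms[symmetric] mem_value_group using theta_notin[OF that] by blast
    then show ?thesis by (rule add_subgroupD(4)[OF add_subgroup_value_group[OF subfield]])
  qed
  then show "distances \<subseteq> value_group v K" by (auto simp: distances_def)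
qed

lemma v_a_minus_wp_Fin: "c \<in> K \<Longrightarrow> v (a - wp c) = Fin (nmult p (approx_val c))"
  by (simp add: v_a_minus_wp v_theta_diff nmult_Fin)

lemma wp_upper_bound_iff:
  "(\<forall>c\<in>K. \<forall>h\<in>H. v (a - wp c) < Fin h) \<longleftrightarrow> (\<forall>s\<in>distances. \<forall>h\<in>H. - nmult p s < h)"
  by (simp add: distances_def v_a_minus_wp_Fin nmult_minus)

lemma exists_wp_ge_iff:
  assumes "b \<in> K" "b \<noteq> 0"
  shows "(\<exists>c\<in>K. - v b \<le> v (a - wp c)) \<longleftrightarrow> (\<exists>s\<in>distances. nmult p s \<le> val b)"
  using assms by (simp add: distances_def v_a_minus_wp_Fin nmult_minus v_eq_Fin minus_le_iff)

text \<open>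
  The element \<open>b = 0\<close> has no counterpart on the right-hand side, but imposes no condition on the left
  either, since \<open>- v 0\<close> is the least extended value.
\<close>

lemma cofinal_wp_iff:
  "(\<forall>b\<in>K. (\<forall>h\<in>H. Fin h < v b) \<longrightarrow> (\<exists>c\<in>K. - v b \<le> v (a - wp c))) \<longleftrightarrow>
    (\<forall>\<alpha>\<in>elems_above (value_group v K) H. \<exists>s\<in>distances. nmult p s \<le> \<alpha>)"
proof (intro iffI ballI impI)
  fix \<alpha> assume L: "\<forall>b\<in>K. (\<forall>h\<in>H. Fin h < v b) \<longrightarrow> (\<exists>c\<in>K. - v b \<le> v (a - wp c))"
    and \<alpha>: "\<alpha> \<in> elems_above (value_group v K) H"
  then obtain b where b: "b \<in> K" "b \<noteq> 0" "val b = \<alpha>" by (auto simp: elems_above_def mem_value_group)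
  moreover have "\<forall>h\<in>H. Fin h < v b" using b \<alpha> by (simp add: elems_above_def v_eq_Fin)
  ultimately have "\<exists>c\<in>K. - v b \<le> v (a - wp c)" using L by blast
  then show "\<exists>s\<in>distances. nmult p s \<le> \<alpha>" using exists_wp_ge_iff[OF b(1,2)] b(3) by simp
next
  fix b assume R: "\<forall>\<alpha>\<in>elems_above (value_group v K) H. \<exists>s\<in>distances. nmult p s \<le> \<alpha>"
    and b: "b \<in> K" "\<forall>h\<in>H. Fin h < v b"
  show "\<exists>c\<in>K. - v b \<le> v (a - wp c)"
  proof (cases "b = 0")
    case True
    then show ?thesis using K_closed(1) by (intro bexI[of _ 0]) simp
  next
    case False
    then have "val b \<in> elems_above (value_group v K) H"
      using b by (auto simp: elems_above_def mem_value_group v_eq_Fin)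
    then show ?thesis using exists_wp_ge_iff[OF b(1) False] R by blast
  qed
qed

lemma rank_one_wp_iff:
  "(\<forall>b\<in>val_ideal v K. \<exists>c\<in>K. - v b \<le> v (a - wp c)) \<longleftrightarrow>
    (\<forall>\<alpha>\<in>value_group v K. 0 < \<alpha> \<longrightarrow> (\<exists>s\<in>distances. nmult p s \<le> \<alpha>))"
  using cofinal_wp_iff[of "{0}"] by (auto simp: val_ideal_def elems_above_def zero_extended_def)

end

section \<open>Artin-Schreier defect extensions\<close>

text \<open>
  The defect is greater than 1 and divides the prime degree, so nothing is left for the other two
  factors.
\<close>

lemma defect_prime_degree:
  assumes "defect_extension v K" "ext_degree K = p" "prime p"
  shows "ramification_index v K = 1" "inertia_degree v K = 1"
proof -
  obtain \<nu> :: nat where "p = res_char_exponent v K ^ \<nu> * (ramification_index v K * inertia_degree v K)"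
      and gt: "res_char_exponent v K ^ \<nu> > 1"
    using assms(1,2) by (auto simp: defect_extension_def mult.assoc)
  moreover define r where "r = res_char_exponent v K ^ \<nu>"
  moreover define m where "m = ramification_index v K * inertia_degree v K"
  ultimately have "p = r * m" "r > 1" by simp_all
  then have "m = 1" using prime_product[of r m] assms(3) by auto
  then show "ramification_index v K = 1" "inertia_degree v K = 1" by (simp_all add: m_def)
qed

text \<open>
  Otherwise \<open>K\<close>, the fixed field of the Galois group, would be the whole field.
\<close>

lemma Gal_nontrivial:
  fixes K :: "'l::field set"
  assumes K: "subfield K ring_of_type_algebra" and "galois_extension K" and deg: "ext_degree K \<noteq> 1"
  shows "Gal K - {id} \<noteq> {}"
proof
  let ?A = "ring_of_type_algebra :: 'l ring"
  interpret A: ring ?A by (rule ring_from_type_algebra)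
  assume "Gal K - {id} = {}"
  then have "{x. \<forall>\<sigma>\<in>Gal K. \<sigma> x = x} = UNIV" by auto
  then have "K = UNIV" using assms(2) by (simp add: galois_extension_def)
  then have "ext_degree K = 1"
    using A.dimI[OF K A.dimension_one[OF K]] by (simp add: ext_degree_def over_def)
  then show False using deg by simp
qed

theorem theorem1p7:
  fixes v :: "'l::field \<Rightarrow> 'g::linordered_ab_group_add extended"
    and K :: "'l set"
    and \<theta> a :: 'l
    and p :: nat
  assumes val: "valuation v"
    and AS: "artin_schreier_extension K"
    and p: "p = CHAR('l)"
    and defect: "defect_extension v K"
    and gen: "generates K \<theta>"
    and root: "\<theta> ^ p - \<theta> = a"
    and a: "a \<in> K"
  shows
    "(\<forall>c\<in>K. v (\<theta> - c) < 0 \<and> v (a - wp c) = nmult p (v (\<theta> - c)))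
   \<and> value_set v a (wp ` K) = nmult p ` value_set v \<theta> K
   \<and> (independent_defect v K \<longleftrightarrow>
        (\<exists>H. strongly_convex_subgroup H (value_group v K) \<and>
          value_set v \<theta> K = Fin ` uminus ` elems_above (value_group v K) H))
   \<and> (independent_defect v K \<longleftrightarrow>
        (\<exists>H. strongly_convex_subgroup H (value_group v K) \<and>
          value_set v a (wp ` K) = Fin ` uminus ` elems_above (nmult p ` value_group v K) H))
   \<and> (independent_defect v K \<longleftrightarrow>
        (\<exists>H. strongly_convex_subgroup H (value_group v K) \<and>
          (\<forall>c\<in>K. \<forall>h\<in>H. v (a - wp c) < Fin h) \<and>
          (\<forall>b\<in>K. (\<forall>h\<in>H. Fin h < v b) \<longrightarrow> (\<exists>c\<in>K. - v b \<le> v (a - wp c)))))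
   \<and> (n_divisible p (value_group v K) \<longrightarrow>
        (independent_defect v K \<longleftrightarrow> nmult p ` value_set v \<theta> K = value_set v \<theta> K) \<and>
        (independent_defect v K \<longleftrightarrow> value_set v a (wp ` K) = value_set v \<theta> K))
   \<and> (rank_one (value_group v K) \<longrightarrow>
        (independent_defect v K \<longleftrightarrow>
          (\<exists>H. strongly_convex_subgroup H (value_group v K) \<and>
            (\<forall>b\<in>K. (\<forall>h\<in>H. Fin h < v b) \<longrightarrow> (\<exists>c\<in>K. - v b \<le> v (a - wp c))))) \<and>
        ((\<exists>H. strongly_convex_subgroup H (value_group v K) \<and>
            (\<forall>b\<in>K. (\<forall>h\<in>H. Fin h < v b) \<longrightarrow> (\<exists>c\<in>K. - v b \<le> v (a - wp c)))) \<longleftrightarrow>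
          (\<forall>b\<in>val_ideal v K. \<exists>c\<in>K. - v b \<le> v (a - wp c))))"
proof -
  interpret krull_valuation v by standard (rule val)
  have K: "subfield K ring_of_type_algebra" and galois: "galois_extension K" and degree: "ext_degree K = p"
    and "CHAR('l) > 0"
    using AS p by (auto simp: artin_schreier_extension_def)
  have prime: "prime p" using prime_CHAR_semidom[where ?'a = 'l] \<open>CHAR('l) > 0\<close> p by simp
  note ef = defect_prime_degree[OF defect degree prime]
  have fin: "finite_extension K" and uni: "unibranched v K" using defect by (auto simp: defect_extension_def)
  have groups: "value_group v UNIV = value_group v K" using ef(1) K by (rule value_group_whole)
  note better = exists_better_approximation[OF K fin ef]
  note repr = generates_imp_poly[OF K fin gen]
  \<comment> \<open>Subtracting the Artin-Schreier equations of \<open>\<theta>\<close> and \<open>\<sigma> \<theta>\<close> gives \<open>i\<^sup>p = i\<close>.\<close>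
  have shift: "\<exists>i. \<sigma> \<theta> = \<theta> + i \<and> v i = 0" if \<sigma>: "\<sigma> \<in> Gal K - {id}" for \<sigma>
  proof -
    have "\<sigma> \<theta> \<noteq> \<theta>"
    proof
      assume fixed: "\<sigma> \<theta> = \<theta>"
      have "\<sigma> b = b" for b
        using repr[of b] Gal_poly[of \<sigma> K _ \<theta>] \<sigma> fixed subfield_0[OF K] by auto
      then show False using \<sigma> by auto
    qed
    define i where "i = \<sigma> \<theta> - \<theta>"
    have i: "i \<noteq> 0" using \<open>\<sigma> \<theta> \<noteq> \<theta>\<close> by (simp add: i_def)
    have pow: "\<sigma> (x ^ n) = \<sigma> x ^ n" for x n
      using GalD(2,3)[of \<sigma> K] \<sigma> subfield_1[OF K] by (induction n) auto
    have "\<theta> ^ p = \<theta> + a" using root by (simp add: algebra_simps)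
    then have "\<sigma> \<theta> ^ p = \<sigma> \<theta> + a" using GalD(1,3)[of \<sigma> K] \<sigma> a by (simp flip: pow)
    moreover have "\<sigma> \<theta> ^ p = \<theta> ^ p + i ^ p"
      using freshmans_dream[where ?'a = 'l, of p \<theta> i] prime p by (simp add: i_def)
    ultimately have "i ^ 1 = i ^ p" using \<open>\<theta> ^ p = \<theta> + a\<close> by (simp add: i_def algebra_simps)
    then have "val i = 0" using val_eq_0_of_equal_powers[OF i] prime_gt_1_nat[OF prime] by blast
    then show ?thesis using i by (intro exI[of _ i]) (simp add: i_def[symmetric] v_eq_Fin zero_extended_def, simp add: i_def)
  qed
  obtain \<sigma> where \<sigma>: "\<sigma> \<in> Gal K - {id}"
    using Gal_nontrivial[OF K galois] degree prime_gt_1_nat[OF prime] by auto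
  obtain i where i: "\<sigma> \<theta> = \<theta> + i" "v i = 0" using shift[OF \<sigma>] by blast
  have \<theta>_notin: "\<theta> - c \<noteq> 0" if "c \<in> K" for c
    using i GalD(3)[of \<sigma> K c] \<sigma> that by (auto simp: zero_extended_def)
  have no_best: "\<exists>d\<in>K. v (\<theta> - c) < v (\<theta> - d)" if c: "c \<in> K" for c
  proof -
    obtain e where "e \<in> K" "v (\<theta> - c) < v (\<theta> - c - e)" using better[OF \<theta>_notin[OF c]] by blast
    then show ?thesis using subfield_add[OF K c, of e] by (intro bexI[of _ "c + e"]) (simp_all add: diff_diff_eq)
  qed
  have negative: "v (\<theta> - c) < 0" if c: "c \<in> K" for c
  proof (rule ccontr)
    assume "\<not> v (\<theta> - c) < 0"
    then obtain d where d: "d \<in> K" "0 < v (\<theta> - d)" using no_best[OF c] by (auto simp: not_less)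
    have "\<sigma> (\<theta> - d) + d = \<theta> + i"
      using GalD(1)[of \<sigma> K "\<theta> - d" d] GalD(3)[of \<sigma> K d] \<sigma> d i(1) by auto
    then have "i = \<sigma> (\<theta> - d) - (\<theta> - d)" by (simp add: algebra_simps)
    moreover have "v (\<sigma> (\<theta> - d)) = v (\<theta> - d)" using Gal_preserves_valuation[OF K _ uni groups] \<sigma> by blast
    ultimately have "0 < v i" using d(2) v_diff_greater by metis
    then show False using i(2) by simp
  qed
  interpret artin_schreier_approximation v K \<theta> p a
    by (intro artin_schreier_approximation.intro immediate_approximation.intro krull_valuation_axioms
        immediate_approximation_axioms.intro artin_schreier_approximation_axioms.intro)
      (use K no_best prime p root a negative in simp_all)
  interpret S: positive_final_segment "value_group v K" distances p
    by (rule positive_final_segment_distances[OF groups])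
  let ?G = "value_group v K"
  have sigma: "sigma_set v \<tau> = Fin ` distances" if \<tau>: "\<tau> \<in> Gal K - {id}" for \<tau>
  proof -
    obtain j where "\<tau> \<theta> = \<theta> + j" "v j = 0" using shift[OF \<tau>] by blast
    then show ?thesis using \<tau> by (intro sigma_set_eq_distances[OF repr groups]) auto
  qed
  have Fin_inj: "Fin ` A = Fin ` B \<longleftrightarrow> A = B" for A B :: "'g set"
    by (rule inj_image_eq_iff) (simp add: inj_def)
  have uminus_inj: "uminus ` A = uminus ` B \<longleftrightarrow> A = B" for A B :: "'g set"
    by (rule inj_image_eq_iff) (simp add: inj_def)
  have indep: "independent_defect v K \<longleftrightarrow> S.above_strongly_convex"
    unfolding independent_defect_def S.above_strongly_convex_def groups
    using \<sigma> by (metis (no_types, lifting) Fin_inj sigma)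
  have Fin_nmult: "nmult p ` Fin ` uminus ` A = Fin ` uminus ` nmult p ` A" for A :: "'g set"
    by (simp add: image_image nmult_Fin nmult_minus)
  have value_a: "value_set v a (wp ` K) = Fin ` uminus ` nmult p ` distances"
    by (simp only: value_set_a value_set_theta Fin_nmult)
  show ?thesis
    unfolding indep cofinal_wp_iff wp_upper_bound_iff rank_one_wp_iff
  proof (intro conjI impI ballI)
    show "S.above_strongly_convex \<longleftrightarrow> (\<exists>H. strongly_convex_subgroup H ?G \<and>
        value_set v \<theta> K = Fin ` uminus ` elems_above ?G H)"
      by (simp only: value_set_theta Fin_inj uminus_inj S.above_strongly_convex_def)
    show "S.above_strongly_convex \<longleftrightarrow> (\<exists>H. strongly_convex_subgroup H ?G \<and>
        value_set v a (wp ` K) = Fin ` uminus ` elems_above (nmult p ` ?G) H)"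
      by (simp only: value_a Fin_inj uminus_inj S.scaled_iff)
    assume div: "n_divisible p ?G"
    show "S.above_strongly_convex \<longleftrightarrow> nmult p ` value_set v \<theta> K = value_set v \<theta> K"
      by (simp only: value_set_theta Fin_nmult Fin_inj uminus_inj S.divisible_iff[OF div])
    show "S.above_strongly_convex \<longleftrightarrow> value_set v a (wp ` K) = value_set v \<theta> K"
      by (simp only: value_a value_set_theta Fin_inj uminus_inj S.divisible_iff[OF div])
  qed (use negative v_a_minus_wp value_set_a S.cofinal_iff S.rank_one_iff in blast)+
qed

end
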